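(* Let $\Gamma$ be a $C^2$, strictly convex, $\mathbb{D}_2$-symmetric billiard curve, and let $Z$ be one of its $\mathbb{D}_2$-symmetric $2$-periodic Birkhoff billiard orbits. Let $L=\|Z_{i+1}-Z_i\|$ and $\kappa=\kappa(Z_i)$; both are independent of $i$. Let $s\ge2$ be an integer and $p=2s$. If $\kappa L<2\cos^2(\pi/p)$, then $\Gamma$ admits a $\mathbb{D}_2$-symmetric non-Birkhoff periodic billiard orbit $z$ of minimal period $p$ and rotation number $\frac12$ which is of type II. That is: - $R(z_i)=z_{k-i}$ for all $i$, for some (unique) odd $k$ with $0<k<p$; - and either $S(z_i)=z_{p/2+i}$ for all $i$, or $(RS)(z_i)=z_{p/2+i}$ for all $i$. Moreover there are lifts $x$ of $z$ and $X$ of $Z$ in $\mathbb{X}_{p,s}$ such that $x-X$ changes sign exactly $2$ times per period $p$.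
   Context: $\mathbb{D}_2=\langle R,S\rangle$, where $R$ is rotation by $\pi$ and $S$ is the reflection in the horizontal axis. A billiard curve is a $C^2$ simple closed curve $\Gamma$ bounding a strictly convex domain. It is parametrized counterclockwise by a $1$-periodic $C^2$ immersion $\gamma$ descending to an embedding of $\mathbb{R}/\mathbb{Z}$, and chosen equivariant: $\gamma(x+1/2)=R\gamma(x)$, $\gamma(-x)=S\gamma(x)$. $\kappa$ denotes curvature. A billiard sequence is $z\in\Gamma^{\mathbb{Z}}$ with $z_i\ne z_{i+1}$. It is a billiard orbit if the billiard reflection law (angle of incidence equals angle of reflection with respect to the tangent) holds at every $z_i$. Lifts $x$ satisfy $\gamma(x_i)=z_i$ and $0<x_{i+1}-x_i<1$. $\mathbb{X}_{p,q}=\{x:x_{i+p}=x_i+q\}$. The rotation number is $\lim x_i/i$. A real sequence $x$ is Birkhoff if $x_i\le x_j+l\Rightarrow x_{i+m}\le x_{j+m}+l$ for all integers $i,j,l,m$. A billiard sequence is Birkhoff iff its lift is. $z$ is $G$-symmetric, for $G\subset\mathbb{D}_2$, if each $g\in G$ satisfies $g(z_i)=z_{k+i}$ for all $i$ or $g(z_i)=z_{k-i}$ for all $i$, for some $k=k(g)\in\mathbb{Z}$. *)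

theory Defs
  imports "HOL-Complex_Analysis.Complex_Analysis"
begin

definition Rrot :: "complex \<Rightarrow> complex" where "Rrot w = - w"
definition Sref :: "complex \<Rightarrow> complex" where "Sref w = cnj w"

definition D2 :: "(complex \<Rightarrow> complex) set" where
  "D2 = {id, Rrot, Sref, Rrot \<circ> Sref}"

definition C2 :: "(real \<Rightarrow> complex) \<Rightarrow> bool" where
  "C2 \<gamma> \<longleftrightarrow> (\<exists>\<gamma>1 \<gamma>2. (\<forall>t. (\<gamma> has_vector_derivative \<gamma>1 t) (at t)) \<and>
                      (\<forall>t. (\<gamma>1 has_vector_derivative \<gamma>2 t) (at t)) \<and>
                      continuous_on UNIV \<gamma>2)"

definition d1 :: "(real \<Rightarrow> complex) \<Rightarrow> real \<Rightarrow> complex" where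
  "d1 \<gamma> t = vector_derivative \<gamma> (at t)"

definition d2 :: "(real \<Rightarrow> complex) \<Rightarrow> real \<Rightarrow> complex" where
  "d2 \<gamma> t = vector_derivative (d1 \<gamma>) (at t)"

definition curvature :: "(real \<Rightarrow> complex) \<Rightarrow> real \<Rightarrow> real" where
  "curvature \<gamma> t = Im (cnj (d1 \<gamma> t) * d2 \<gamma> t) / (cmod (d1 \<gamma> t)) ^ 3"

text \<open>Curvature at a point w of the curve Gamma (the parameter is unique in [0,1)).\<close>
definition curvature_at :: "(real \<Rightarrow> complex) \<Rightarrow> complex \<Rightarrow> real" where
  "curvature_at \<gamma> w = curvature \<gamma> (THE t. t \<in> {0..<1} \<and> \<gamma> t = w)"

definition curve :: "(real \<Rightarrow> complex) \<Rightarrow> complex set" where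
  "curve \<gamma> = \<gamma> ` {0..1}"

definition billiard_curve :: "(real \<Rightarrow> complex) \<Rightarrow> bool" where
  "billiard_curve \<gamma> \<longleftrightarrow>
     C2 \<gamma> \<and> (\<forall>t. \<gamma> (t + 1) = \<gamma> t) \<and> (\<forall>t. d1 \<gamma> t \<noteq> 0) \<and> inj_on \<gamma> {0..<1} \<and>
     (\<exists>K. compact K \<and> convex K \<and> interior K \<noteq> {} \<and> frontier K = curve \<gamma> \<and>
          (\<forall>a\<in>K. \<forall>b\<in>K. a \<noteq> b \<longrightarrow> open_segment a b \<subseteq> interior K) \<and>
          (\<forall>w\<in>interior K. winding_number \<gamma> w = 1))"

definition D2_equivariant :: "(real \<Rightarrow> complex) \<Rightarrow> bool" where
  "D2_equivariant \<gamma> \<longleftrightarrow> (\<forall>t. \<gamma> (t + 1/2) = Rrot (\<gamma> t) \<and> \<gamma> (- t) = Sref (\<gamma> t))"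

definition billiard_sequence :: "(real \<Rightarrow> complex) \<Rightarrow> (int \<Rightarrow> complex) \<Rightarrow> bool" where
  "billiard_sequence \<gamma> z \<longleftrightarrow> (\<forall>i. z i \<in> curve \<gamma> \<and> z i \<noteq> z (i + 1))"

definition is_lift :: "(real \<Rightarrow> complex) \<Rightarrow> (int \<Rightarrow> complex) \<Rightarrow> (int \<Rightarrow> real) \<Rightarrow> bool" where
  "is_lift \<gamma> z x \<longleftrightarrow> (\<forall>i. \<gamma> (x i) = z i \<and> 0 < x (i + 1) - x i \<and> x (i + 1) - x i < 1)"

text \<open>Reflection law at every point: the unit vectors from z_i towards z_(i-1) and z_(i+1)
  make equal angles with the tangent line, i.e. their tangential components cancel.\<close>
definition billiard_orbit :: "(real \<Rightarrow> complex) \<Rightarrow> (int \<Rightarrow> complex) \<Rightarrow> bool" where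
  "billiard_orbit \<gamma> z \<longleftrightarrow> billiard_sequence \<gamma> z \<and>
     (\<forall>i t. \<gamma> t = z i \<longrightarrow>
        inner (d1 \<gamma> t) ((z (i - 1) - z i) / of_real (cmod (z (i - 1) - z i)))
      + inner (d1 \<gamma> t) ((z (i + 1) - z i) / of_real (cmod (z (i + 1) - z i))) = 0)"

definition X_pq :: "int \<Rightarrow> int \<Rightarrow> (int \<Rightarrow> real) set" where
  "X_pq p q = {x. \<forall>i. x (i + p) = x i + of_int q}"

definition birkhoff :: "(int \<Rightarrow> real) \<Rightarrow> bool" where
  "birkhoff x \<longleftrightarrow> (\<forall>i j l m. x i \<le> x j + of_int l \<longrightarrow> x (i + m) \<le> x (j + m) + of_int l)"

definition birkhoff_seq :: "(real \<Rightarrow> complex) \<Rightarrow> (int \<Rightarrow> complex) \<Rightarrow> bool" where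
  "birkhoff_seq \<gamma> z \<longleftrightarrow> (\<exists>x. is_lift \<gamma> z x \<and> birkhoff x)"

definition has_rotation_number :: "(real \<Rightarrow> complex) \<Rightarrow> (int \<Rightarrow> complex) \<Rightarrow> real \<Rightarrow> bool" where
  "has_rotation_number \<gamma> z \<omega> \<longleftrightarrow>
     (\<exists>x. is_lift \<gamma> z x \<and> (\<lambda>n::nat. x (int n) / real n) \<longlonglongrightarrow> \<omega>)"

definition periodic_with :: "(int \<Rightarrow> complex) \<Rightarrow> int \<Rightarrow> bool" where
  "periodic_with z p \<longleftrightarrow> (\<forall>i. z (i + p) = z i)"

definition minimal_period :: "(int \<Rightarrow> complex) \<Rightarrow> int \<Rightarrow> bool" where
  "minimal_period z p \<longleftrightarrow> 0 < p \<and> periodic_with z p \<and> (\<forall>m. 0 < m \<and> m < p \<longrightarrow> \<not> periodic_with z m)"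

definition G_symmetric :: "(complex \<Rightarrow> complex) set \<Rightarrow> (int \<Rightarrow> complex) \<Rightarrow> bool" where
  "G_symmetric G z \<longleftrightarrow>
     (\<forall>g\<in>G. \<exists>k::int. (\<forall>i. g (z i) = z (k + i)) \<or> (\<forall>i. g (z i) = z (k - i)))"

definition sign_changes :: "int \<Rightarrow> (int \<Rightarrow> real) \<Rightarrow> nat" where
  "sign_changes p d =
     (let L = filter (\<lambda>v. v \<noteq> 0) (map d [0..p - 1])
      in card {j. j < length L \<and> L ! j * L ! ((j + 1) mod length L) < 0})"

end

theory Submission
  imports Defs
begin

text \<open>Rotate the plane and shift the parameter so that the given 2-periodic orbit becomes
  \<open>\<plusminus>\<delta> 0\<close> with \<open>\<delta> 0 > 0\<close>, and look for an orbit \<open>z i = (-1)^i \<delta> (\<xi> i)\<close> with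
  \<open>\<xi> (i + s) = - \<xi> i\<close> and \<open>\<xi> (-1 - i) = \<xi> i\<close>. The reflection law becomes the second order
  recurrence \<open>D (\<xi> i) (\<xi> (i - 1)) + D (\<xi> i) (\<xi> (i + 1)) = 0\<close>, where \<open>D u v\<close> is the tangential
  component at \<open>\<delta> u\<close> of the unit vector in the direction \<open>\<delta> u + \<delta> v\<close>. Strict convexity makes
  \<open>D\<close> strictly increasing in \<open>v\<close>, so the method of sub- and supersolutions applies on a quarter
  of a period. The constant \<open>1/4\<close>, the other symmetric 2-periodic orbit, is a supersolution. For small
  \<open>t > 0\<close> the cosine \<open>t cos (\<pi> (2 i + 1) / (2 s))\<close>, which has the required symmetries, is a subsolution,
  because the linearisation at \<open>0\<close> acts on it as a positive multiple of
  \<open>2 cos\<^sup>2 (\<pi> / (2 s)) - \<kappa> L\<close>. The resulting \<open>\<xi>\<close> is positive on a half period and negative on the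
  other, which gives the minimal period, the failure of the Birkhoff property and the two sign
  changes.\<close>

section \<open>Sub- and supersolutions of monotone recurrences\<close>

text \<open>Truncated subtraction in \<open>\<eta> (i - 1)\<close> at \<open>i = 0\<close> encodes the boundary condition
  \<open>\<xi> (-1) = \<xi> 0\<close>. The solution is the pointwise supremum of the subsolutions: it is a subsolution
  by continuity, and at an index with \<open>E \<xi> m i > 0\<close> it could be raised.\<close>
lemma perron_solution:
  fixes D :: "real \<Rightarrow> real \<Rightarrow> real" and e :: "real \<Rightarrow> real" and c :: "nat \<Rightarrow> real"
  defines "E \<equiv> \<lambda>\<eta> m i. D (\<eta> i) (\<eta> (i - 1)) + (if Suc i < m then D (\<eta> i) (\<eta> (Suc i)) else e (\<eta> i))"
  assumes mono: "\<And>u v v'. \<lbrakk>0 \<le> u; u \<le> b; 0 \<le> v; v \<le> v'; v' \<le> b\<rbrakk> \<Longrightarrow> D u v \<le> D u v'"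
    and strict: "\<And>v. \<lbrakk>0 \<le> v; v < b\<rbrakk> \<Longrightarrow> D b v < D b b" and top: "D b b = 0"
    and cont: "\<And>v. \<lbrakk>0 \<le> v; v \<le> b\<rbrakk> \<Longrightarrow> continuous_on {0..b} (\<lambda>u. D u v)"
    and cont_e: "continuous_on {0..b} e" and e_top: "e b < 0"
    and c: "\<And>i. i < m \<Longrightarrow> 0 \<le> c i \<and> c i \<le> b" and sub: "\<And>i. i < m \<Longrightarrow> 0 \<le> E c m i"
  shows "\<exists>\<xi>. \<forall>i<m. c i \<le> \<xi> i \<and> \<xi> i < b \<and> E \<xi> m i = 0"
proof -
  define Sub where "Sub = {\<eta>. \<forall>i<m. c i \<le> \<eta> i \<and> \<eta> i \<le> b \<and> 0 \<le> E \<eta> m i}"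
  define \<xi> where "\<xi> i = Sup ((\<lambda>\<eta>. \<eta> i) ` Sub)" for i
  define h where "h i u = D u (\<xi> (i - 1)) + (if Suc i < m then D u (\<xi> (Suc i)) else e u)" for i u
  have c_Sub: "c \<in> Sub"
    using c sub by (auto simp: Sub_def)
  have bdd: "bdd_above ((\<lambda>\<eta>. \<eta> i) ` Sub)" if "i < m" for i
    using that by (intro bdd_aboveI[of _ b]) (auto simp: Sub_def)
  have le_\<xi>: "\<eta> i \<le> \<xi> i" if "\<eta> \<in> Sub" "i < m" for \<eta> i
    unfolding \<xi>_def using that bdd by (intro cSup_upper) auto
  have \<xi>_le: "\<xi> i \<le> b" if "i < m" for i
    unfolding \<xi>_def using that c_Sub by (intro cSup_least) (auto simp: Sub_def)
  have c_le: "c i \<le> \<xi> i" if "i < m" for i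
    using le_\<xi> c_Sub that by blast
  have \<xi>_ge: "0 \<le> \<xi> i" if "i < m" for i
    using c_le[OF that] c[OF that] by linarith
  have cont_h: "continuous_on {0..b} (h i)" if "i < m" for i
    unfolding h_def using that \<xi>_le \<xi>_ge
    by (cases "Suc i < m") (auto intro!: continuous_on_add cont cont_e)
  have E_\<xi>: "E \<xi> m i = h i (\<xi> i)" for i
    by (simp add: E_def h_def)
  \<comment> \<open>Freezing the neighbours at their suprema only raises the expression, so each
    value \<open>\<eta> i\<close> satisfies a condition on one real variable. That condition is
    closed and hence passes to the supremum.\<close>
  have h_nonneg: "0 \<le> h i (\<xi> i)" if i: "i < m" for i
  proof -
    let ?A = "(\<lambda>\<eta>. \<eta> i) ` Sub" and ?B = "{u \<in> {0..b}. h i u \<in> {0..}}"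
    have "closed ?B"
      using continuous_closed_preimage[OF cont_h[OF i], of "{0..}"]
      by (simp add: vimage_def Int_def)
    moreover have "?A \<subseteq> ?B"
    proof
      fix u assume "u \<in> ?A"
      then obtain \<eta> where \<eta>: "\<eta> \<in> Sub" "u = \<eta> i" by auto
      have u: "0 \<le> u" "u \<le> b" and E: "0 \<le> E \<eta> m i"
        using \<eta> i c[OF i] by (force simp: Sub_def)+
      have nn: "0 \<le> \<eta> j" if "j < m" for j
        using \<eta>(1) c that by (force simp: Sub_def)
      have "D u (\<eta> (i - 1)) \<le> D u (\<xi> (i - 1))"
        using mono u nn le_\<xi> \<eta>(1) \<xi>_le i by simp
      moreover have "D u (\<eta> (Suc i)) \<le> D u (\<xi> (Suc i))" if "Suc i < m"
        using mono u nn le_\<xi> \<eta>(1) \<xi>_le that by simp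
      ultimately have "E \<eta> m i \<le> h i u"
        by (auto simp: E_def h_def \<eta>(2))
      then show "u \<in> ?B" using E u by auto
    qed
    ultimately have "closure ?A \<subseteq> ?B"
      by (simp add: closure_minimal)
    moreover have "\<xi> i \<in> closure ?A"
      unfolding \<xi>_def using c_Sub bdd[OF i] by (intro closure_contains_Sup) auto
    ultimately show ?thesis by auto
  qed
  have lt: "\<xi> i < b" if "i < m" for i
  proof (rule ccontr)
    assume "\<not> \<xi> i < b"
    then have i: "i < m \<and> \<xi> i = b" using \<xi>_le that by force
    \<comment> \<open>At the last index touching the barrier the right-hand term is strictly
      negative: either the next value lies below \<open>b\<close>, or the term is
      \<open>e b\<close>. The left-hand term is at most \<open>D b b = 0\<close>.\<close>
    define k where "k = Greatest (\<lambda>i. i < m \<and> \<xi> i = b)"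
    have k: "k < m \<and> \<xi> k = b"
      unfolding k_def by (rule GreatestI_nat[where b=m], rule i) auto
    have k_max: "j \<le> k" if "j < m" "\<xi> j = b" for j
      unfolding k_def by (rule Greatest_le_nat[where b=m]) (use that in auto)
    have "0 \<le> b" "k - 1 < m" using \<xi>_ge k by auto
    then have "D b (\<xi> (k - 1)) \<le> 0"
      using mono[of b "\<xi> (k - 1)" b] \<xi>_ge[of "k - 1"] \<xi>_le[of "k - 1"] unfolding top by blast
    moreover have "(if Suc k < m then D b (\<xi> (Suc k)) else e b) < 0"
      using strict[of "\<xi> (Suc k)"] top \<xi>_ge \<xi>_le k_max e_top by force
    ultimately have "h k (\<xi> k) < 0"
      using k by (simp add: h_def)
    then show False using h_nonneg k by force
  qed
  have "h i (\<xi> i) = 0" if i: "i < m" for i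
  proof (rule ccontr)
    assume "h i (\<xi> i) \<noteq> 0"
    then have hp: "0 < h i (\<xi> i)" using h_nonneg[OF i] by simp
    have "\<xi> i \<in> {0..b}" using \<xi>_ge \<xi>_le i by auto
    then obtain d where d: "d > 0" "\<And>u. u \<in> {0..b} \<Longrightarrow> dist u (\<xi> i) < d \<Longrightarrow> dist (h i u) (h i (\<xi> i)) < h i (\<xi> i)"
      using cont_h[OF i] hp unfolding continuous_on_iff by metis
    \<comment> \<open>Raising entry \<open>i\<close> alone can only increase the expressions at the
      other indices. The cap at \<open>b\<close> still leaves room because of
      \<open>lt\<close>.\<close>
    define u where "u = min b (\<xi> i + d/2)"
    have u: "\<xi> i < u" "u \<le> b" "0 \<le> u" "dist u (\<xi> i) < d"
      using d(1) lt[OF i] \<xi>_ge[OF i] by (auto simp: u_def dist_real_def)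
    then have hu: "0 < h i u"
      using d(2)[of u] by (auto simp: dist_real_def)
    define \<eta> where "\<eta> = \<xi>(i := u)"
    have \<eta>: "\<xi> j \<le> \<eta> j" "\<eta> j \<le> b" "0 \<le> \<eta> j" if "j < m" for j
      using u \<xi>_le \<xi>_ge that by (auto simp: \<eta>_def)
    have "h j (\<eta> j) \<le> E \<eta> m j" if j: "j < m" for j
    proof -
      have "D (\<eta> j) (\<xi> (j - 1)) \<le> D (\<eta> j) (\<eta> (j - 1))"
        using mono \<eta> \<xi>_ge j by simp
      moreover have "D (\<eta> j) (\<xi> (Suc j)) \<le> D (\<eta> j) (\<eta> (Suc j))" if "Suc j < m"
        using mono \<eta> \<xi>_ge j that by simp
      ultimately show ?thesis by (auto simp: E_def h_def)
    qed
    moreover have "0 \<le> h j (\<eta> j)" if "j < m" for j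
      using hu h_nonneg[OF that] by (simp add: \<eta>_def)
    ultimately have "0 \<le> E \<eta> m j" if "j < m" for j
      using that order_trans by blast
    then have "\<eta> \<in> Sub"
      using \<eta> order_trans[OF c_le \<eta>(1)] unfolding Sub_def by auto
    then show False
      using le_\<xi>[of \<eta> i] u(1) i by (simp add: \<eta>_def)
  qed
  then show ?thesis using c_le lt E_\<xi> by metis
qed

lemma pos_of_connected:
  fixes f :: "real \<Rightarrow> real"
  assumes "connected S" "continuous_on S f" "\<And>x. x \<in> S \<Longrightarrow> f x \<noteq> 0" "x \<in> S" "y \<in> S" "0 < f x"
  shows "0 < f y"
proof (rule ccontr)
  assume "\<not> 0 < f y"
  moreover have "connected (f ` S)" using assms by (intro connected_continuous_image)
  ultimately have "0 \<in> f ` S"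
    using assms connectedD_interval[of "f ` S" "f y" "f x" 0] by auto
  then show False using assms(3) by auto
qed

section \<open>The recurrence of a symmetric oval\<close>

text \<open>The axiom \<open>convex\<close> puts every other point strictly to the left of the
  tangent at \<open>\<delta> u\<close>; this combines strict convexity, injectivity modulo 1 and the
  counterclockwise orientation.\<close>

locale symmetric_oval =
  fixes \<delta> \<delta>1 \<delta>2 :: "real \<Rightarrow> complex"
  assumes deriv: "(\<delta> has_vector_derivative \<delta>1 t) (at t)"
    and deriv2: "(\<delta>1 has_vector_derivative \<delta>2 t) (at t)"
    and half: "\<delta> (t + 1/2) = - \<delta> t"
    and reflect: "\<delta> (- t) = cnj (\<delta> t)"
    and convex: "u - v \<notin> \<int> \<Longrightarrow> 0 < Im (cnj (\<delta>1 u) * (\<delta> v - \<delta> u))"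
    and pos: "0 < Re (\<delta> 0)"
begin

text \<open>Since \<open>- \<delta> v\<close> is the antipode of \<open>\<delta> v\<close>, the sum
  \<open>\<delta> u + \<delta> v\<close> is the chord from that antipode to
  \<open>\<delta> u\<close>. The tangent is not normalised: its length is a positive factor
  depending on \<open>u\<close> alone.\<close>

definition D :: "real \<Rightarrow> real \<Rightarrow> real" where
  "D u v = inner (\<delta>1 u) (\<delta> u + \<delta> v) / cmod (\<delta> u + \<delta> v)"

lemma eq_imp_Ints: "\<delta> u = \<delta> v \<Longrightarrow> u - v \<in> \<int>"
  using convex[of u v] by force

text \<open>The sum is minus the chord from \<open>\<delta> u\<close> to
  \<open>\<delta> (v + 1/2)\<close>, and the bound keeps these two parameters distinct modulo
  1.\<close>

lemma cross_less: 
  assumes "\<bar>u - v\<bar> < 1/2"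
  shows "Im (cnj (\<delta>1 u) * (\<delta> u + \<delta> v)) < 0"
proof -
  have "u - (v + 1/2) \<notin> \<int>"
  proof
    assume "u - (v + 1/2) \<in> \<int>"
    then obtain n where "u - (v + 1/2) = of_int n" by (elim Ints_cases)
    then have "real_of_int n < 0" "real_of_int n > -1" using assms by linarith+
    then have "n < 0" "n > -1" by linarith+
    then show False by simp
  qed
  from convex[OF this] show ?thesis by (simp add: half algebra_simps)
qed

lemma add_nonzero: "\<bar>u - v\<bar> < 1/2 \<Longrightarrow> \<delta> u + \<delta> v \<noteq> 0"
  using cross_less by fastforce

lemma \<delta>1_half: "\<delta>1 (t + 1/2) = - \<delta>1 t"
proof -
  have "((\<lambda>x. x + 1/2) has_vector_derivative (1::real)) (at t)"
    by (auto intro!: derivative_eq_intros)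
  then have "((\<lambda>x. - \<delta> (x + 1/2)) has_vector_derivative - \<delta>1 (t + 1/2)) (at t)"
    using vector_diff_chain_at[of "\<lambda>x. x + 1/2" 1 t \<delta> "\<delta>1 (t+1/2)"] deriv
    by (intro has_vector_derivative_minus) (auto simp: o_def)
  then have "(\<delta> has_vector_derivative - \<delta>1 (t + 1/2)) (at t)" by (simp add: half)
  then have "\<delta>1 t = - \<delta>1 (t + 1/2)" using deriv vector_derivative_unique_at by blast
  then show ?thesis by simp
qed

lemma \<delta>1_reflect: "\<delta>1 (- t) = - cnj (\<delta>1 t)"
proof -
  have "(uminus has_vector_derivative (-1::real)) (at t)"
    by (auto intro!: derivative_eq_intros)
  then have "((\<lambda>x. cnj (\<delta> (- x))) has_vector_derivative cnj (- \<delta>1 (- t))) (at t)"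
    using vector_diff_chain_at[of uminus "-1" t \<delta> "\<delta>1 (-t)"] deriv
    by (intro has_vector_derivative_cnj) (auto simp: o_def)
  then have "(\<delta> has_vector_derivative cnj (- \<delta>1 (- t))) (at t)" by (simp add: reflect)
  then have "\<delta>1 t = cnj (- \<delta>1 (- t))" using deriv vector_derivative_unique_at by blast
  then show ?thesis by simp
qed

text \<open>Reflection in the real axis reverses the direction of travel, whence the sign. This
  makes the recurrence compatible with \<open>\<xi> (i + s) = - \<xi> i\<close>.\<close>

lemma D_minus: "D (- u) (- v) = - D u v"
proof -
  have "\<delta> (-u) + \<delta> (-v) = cnj (\<delta> u + \<delta> v)" by (simp add: reflect)
  moreover have "inner (\<delta>1 (-u)) (\<delta> (-u) + \<delta> (-v)) = - inner (\<delta>1 u) (\<delta> u + \<delta> v)"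
    by (simp add: inner_complex_def reflect \<delta>1_reflect algebra_simps)
  ultimately show ?thesis unfolding D_def by (simp only: complex_mod_cnj minus_divide_left)
qed

lemma continuous_\<delta>: "continuous_on S \<delta>"
  by (meson deriv continuous_at_imp_continuous_on has_vector_derivative_continuous)

lemma continuous_\<delta>1: "continuous_on S \<delta>1"
  by (meson deriv2 continuous_at_imp_continuous_on has_vector_derivative_continuous)

text \<open>The derivative of D in its second argument is the product of two cross
  products of tangent vectors with the same chord.\<close>
lemma D_strict_mono:
  assumes "v < v'" "\<bar>u - v\<bar> < 1/2" "\<bar>u - v'\<bar> < 1/2"
  shows "D u v < D u v'"
proof (rule DERIV_pos_imp_increasing[OF assms(1)])
  fix x assume x: "v \<le> x" "x \<le> v'"
  then have ux: "\<bar>u - x\<bar> < 1/2" using assms by arith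
  define w T W where "w = \<delta> u + \<delta> x" and "T = \<delta>1 u" and "W = \<delta>1 x"
  have w0: "w \<noteq> 0" using add_nonzero ux by (simp add: w_def)
  have dw: "((\<lambda>x. \<delta> u + \<delta> x) has_vector_derivative W) (at x)"
    using deriv by (auto intro!: derivative_eq_intros simp: W_def)
  have dn: "((\<lambda>x. inner T (\<delta> u + \<delta> x)) has_real_derivative inner T W) (at x)"
    using bounded_linear.has_vector_derivative[OF bounded_linear_inner_right dw]
    by (simp add: has_real_derivative_iff_has_vector_derivative)
  have dm: "((\<lambda>x. cmod (\<delta> u + \<delta> x)) has_real_derivative inner w W / cmod w) (at x)"
    using has_derivative_compose[OF dw[unfolded has_vector_derivative_def] has_derivative_norm[OF w0[unfolded w_def]]]
    unfolding has_field_derivative_def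
    by (rule has_derivative_eq_rhs) (simp add: w_def sgn_div_norm inner_commute fun_eq_iff divide_inverse mult_ac)
  have "((\<lambda>x. D u x) has_real_derivative
      (inner T W * cmod w - inner T w * (inner w W / cmod w)) / (cmod w * cmod w)) (at x)"
    unfolding D_def using DERIV_divide[OF dn dm] w0 by (simp add: w_def T_def)
  moreover have "(inner T W * cmod w - inner T w * (inner w W / cmod w)) / (cmod w * cmod w)
      = (inner T W * (cmod w)\<^sup>2 - inner T w * inner w W) / (cmod w)^3"
    using w0 by (simp add: field_simps power2_eq_square power3_eq_cube)
  \<comment> \<open>Planar identity: with \<open>T\<close> and \<open>W\<close> resolved along
    \<open>w\<close> and perpendicular to it, subtracting the product of the parallel components
    leaves that of the perpendicular ones.\<close>
  moreover have "inner T W * (cmod w)\<^sup>2 - inner T w * inner w W = Im (cnj T * w) * Im (cnj W * w)"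
    unfolding cmod_power2 by (simp add: inner_complex_def algebra_simps power2_eq_square)
  moreover have "Im (cnj T * w) * Im (cnj W * w) > 0"
    using cross_less[of u x] cross_less[of x u] ux
    by (intro mult_neg_neg) (simp_all add: T_def W_def w_def add.commute abs_minus_commute)
  ultimately show "\<exists>y. DERIV (D u) x :> y \<and> 0 < y"
    using w0 by auto
qed

lemma continuous_D:
  assumes "\<And>u. u \<in> S \<Longrightarrow> \<bar>u - v\<bar> < 1/2"
  shows "continuous_on S (\<lambda>u. D u v)"
  unfolding D_def using assms add_nonzero
  by (auto intro!: continuous_intros continuous_\<delta> continuous_\<delta>1)

section \<open>Position and tangent of the oval on its two symmetry axes\<close>

lemma \<delta>_0: "Im (\<delta> 0) = 0"
  using reflect[of 0] by (simp add: complex_eq_iff)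

lemma \<delta>1_0: "Re (\<delta>1 0) = 0" "0 < Im (\<delta>1 0)"
proof -
  show r: "Re (\<delta>1 0) = 0"
    using \<delta>1_reflect[of 0] by (simp add: complex_eq_iff)
  show "0 < Im (\<delta>1 0)"
    using cross_less[of 0 0] r \<delta>_0 pos by (simp add: zero_less_mult_iff)
qed

text \<open>A point on the imaginary axis coincides with its mirror image, whose parameter is
  \<open>1/2 - x\<close>; this would make \<open>2 * x - 1/2\<close> an integer. So the sign at 0
  persists.\<close>

lemma Re_pos:
  assumes "\<bar>u\<bar> < 1/4"
  shows "0 < Re (\<delta> u)"
proof (rule pos_of_connected[of "{-1/4<..<1/4}" "\<lambda>x. Re (\<delta> x)" 0])
  show "continuous_on {-1/4<..<1/4} (\<lambda>x. Re (\<delta> x))"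
    by (intro continuous_intros continuous_\<delta>)
  show "Re (\<delta> x) \<noteq> 0" if "x \<in> {-1/4<..<1/4}" for x
  proof
    assume "Re (\<delta> x) = 0"
    then have "\<delta> x = \<delta> (- x + 1/2)"
      by (simp only: half reflect) (simp add: complex_eq_iff)
    from eq_imp_Ints[OF this] obtain n where "2 * x - 1/2 = of_int n" by (auto elim: Ints_cases)
    then have "real_of_int n < 0" "real_of_int n > -1" using that
      unfolding greaterThanLessThan_iff by linarith+
    then have "n < 0" "n > -1" by linarith+
    then show False by simp
  qed
qed (use assms pos in auto)

text \<open>Zeros are again excluded by injectivity modulo 1, but
  \<open>Im (\<delta> 0) = 0\<close>, so the initial sign has to come from the upward tangent at
  0.\<close>

lemma Im_pos:
  assumes "0 < u" "u < 1/2"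
  shows "0 < Im (\<delta> u)"
proof -
  have "((\<lambda>x. Im (\<delta> x)) has_real_derivative Im (\<delta>1 0)) (at 0)"
    using bounded_linear.has_vector_derivative[OF bounded_linear_Im deriv] by (simp add: has_real_derivative_iff_has_vector_derivative)
  then obtain d where d: "d > 0" "\<And>h. 0 < h \<Longrightarrow> h < d \<Longrightarrow> Im (\<delta> 0) < Im (\<delta> (0 + h))"
    using DERIV_pos_inc_right \<delta>1_0(2) by blast
  define y where "y = min (d/2) (1/4)"
  show ?thesis
  proof (rule pos_of_connected[of "{0<..<1/2}" "\<lambda>x. Im (\<delta> x)" y])
    show "continuous_on {0<..<1/2} (\<lambda>x. Im (\<delta> x))"
      by (intro continuous_intros continuous_\<delta>)
    show "0 < Im (\<delta> y)" using d(1) d(2)[of y] \<delta>_0 by (auto simp: y_def)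
    show "Im (\<delta> x) \<noteq> 0" if "x \<in> {0<..<1/2}" for x
    proof
      assume "Im (\<delta> x) = 0"
      then have "\<delta> x = \<delta> (- x)" by (simp add: reflect complex_eq_iff)
      from eq_imp_Ints[OF this] obtain n where "2 * x = of_int n" by (auto elim: Ints_cases)
      then have "real_of_int n < 1" "real_of_int n > 0" using that by auto
      then show False by simp
    qed
  qed (use assms d in \<open>auto simp: y_def\<close>)
qed

text \<open>The map \<open>t \<mapsto> 1/2 - t\<close> fixes \<open>1/4\<close> and realises the
  reflection in the imaginary axis, so the point lies on that axis and its tangent is
  horizontal.\<close>

lemma quarter: "Re (\<delta> (1/4)) = 0" "Im (\<delta>1 (1/4)) = 0" "Re (\<delta>1 (1/4)) < 0"
proof -
  show re: "Re (\<delta> (1/4)) = 0"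
    using half[of "-1/4"] reflect[of "1/4"] by (simp add: complex_eq_iff)
  show "Im (\<delta>1 (1/4)) = 0"
    using \<delta>1_half[of "-1/4"] \<delta>1_reflect[of "1/4"] by (simp add: complex_eq_iff)
  show "Re (\<delta>1 (1/4)) < 0"
    using cross_less[of "1/4" "1/4"] Im_pos[of "1/4"] re by (simp add: mult_less_0_iff)
qed

lemma D_quarter: "D (1/4) (1/4) = 0" 
  using quarter by (simp add: D_def inner_complex_def)

text \<open>The two points are mirror images in the real axis, so their sum is a positive real and
  its unit vector is 1 for every such \<open>u\<close>.\<close>

lemma D_antidiagonal: "\<bar>u\<bar> < 1/4 \<Longrightarrow> D u (- u) = Re (\<delta>1 u)"
  using Re_pos[of u] by (simp add: D_def inner_complex_def reflect complex_add_cnj)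

text \<open>The linearisation at the given orbit along the ray \<open>(\<alpha>, \<beta>)\<close>.
  The numerator of \<open>D\<close> vanishes at the origin, so its derivative and the limit of the
  denominator suffice. With curvature \<kappa> and chord length L, the limit is a positive multiple
  of \<alpha> + \<beta> - \<kappa> L \<alpha>.\<close>

lemma D_limit:
  "((\<lambda>t. D (t * \<alpha>) (t * \<beta>) / t) \<longlongrightarrow>
     \<alpha> * Re (\<delta>2 0) + (\<alpha> + \<beta>) * (Im (\<delta>1 0))\<^sup>2 / (2 * Re (\<delta> 0))) (at 0)"
proof -
  define N where "N t = inner (\<delta>1 (t * \<alpha>)) (\<delta> (t * \<alpha>) + \<delta> (t * \<beta>))" for t
  have scale: "((\<lambda>t. f (t * c)) has_vector_derivative c *\<^sub>R f' 0) (at 0)"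
    if "\<And>t. (f has_vector_derivative f' t) (at t)" for f f' :: "real \<Rightarrow> complex" and c
  proof -
    have "((\<lambda>t. t * c) has_vector_derivative c) (at 0)"
      by (auto intro!: derivative_eq_intros simp flip: has_real_derivative_iff_has_vector_derivative)
    from vector_diff_chain_at[OF this, of f "f' 0"] that[of 0] show ?thesis by (simp add: o_def)
  qed
  have "(N has_real_derivative inner (\<delta>1 0) (\<alpha> *\<^sub>R \<delta>1 0 + \<beta> *\<^sub>R \<delta>1 0) + inner (\<alpha> *\<^sub>R \<delta>2 0) (\<delta> 0 + \<delta> 0)) (at 0)"
    using scale[OF deriv, of \<alpha>] scale[OF deriv, of \<beta>] scale[OF deriv2, of \<alpha>]
    unfolding N_def has_vector_derivative_def has_field_derivative_def
    by (auto intro!: derivative_eq_intros simp: fun_eq_iff inner_complex_def algebra_simps)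
  moreover have "N 0 = 0"
    using \<delta>1_0 \<delta>_0 by (simp add: N_def inner_complex_def)
  ultimately have "((\<lambda>t. N t / t) \<longlongrightarrow> (\<alpha> + \<beta>) * (Im (\<delta>1 0))\<^sup>2 + 2 * \<alpha> * Re (\<delta>2 0) * Re (\<delta> 0)) (at 0)"
    using \<delta>1_0(1) \<delta>_0
    by (simp add: has_field_derivative_iff inner_complex_def algebra_simps power2_eq_square)
  moreover have "((\<lambda>t. cmod (\<delta> (t * \<alpha>) + \<delta> (t * \<beta>))) \<longlongrightarrow> 2 * Re (\<delta> 0)) (at 0)"
  proof -
    have "isCont \<delta> 0" using continuous_\<delta>[of UNIV] by (simp add: continuous_on_eq_continuous_at)
    then have "((\<lambda>t. \<delta> (t * c)) \<longlongrightarrow> \<delta> 0) (at 0)" for c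
      by (intro isCont_tendsto_compose[of _ \<delta>]) (auto intro!: tendsto_eq_intros)
    then have "((\<lambda>t. cmod (\<delta> (t * \<alpha>) + \<delta> (t * \<beta>))) \<longlongrightarrow> cmod (\<delta> 0 + \<delta> 0)) (at 0)"
      by (intro tendsto_intros)
    moreover have "\<delta> 0 + \<delta> 0 = of_real (2 * Re (\<delta> 0))"
      using \<delta>_0 by (simp add: complex_eq_iff)
    ultimately show ?thesis using pos by (simp only: norm_of_real) simp
  qed
  ultimately have "((\<lambda>t. N t / t / cmod (\<delta> (t * \<alpha>) + \<delta> (t * \<beta>))) \<longlongrightarrow>
      ((\<alpha> + \<beta>) * (Im (\<delta>1 0))\<^sup>2 + 2 * \<alpha> * Re (\<delta>2 0) * Re (\<delta> 0)) / (2 * Re (\<delta> 0))) (at 0)"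
    using pos by (intro tendsto_divide) auto
  then show ?thesis
    using pos by (simp add: N_def D_def add_divide_distrib mult.commute add.commute)
qed

text \<open>Symmetry leaves only the first \<open>s div 2\<close> values unknown. The antisymmetry
  \<open>\<xi> (s - 1 - i) = - \<xi> i\<close> supplies the value after the last one: its negative
  for even \<open>s\<close>, the middle value 0 for odd \<open>s\<close>.\<close>

lemma exists_half_profile:
  fixes s :: nat
  assumes s: "2 \<le> s"
    and small: "- Re (\<delta>2 0) * Re (\<delta> 0) < (Im (\<delta>1 0))\<^sup>2 * (cos (pi / (2 * s)))\<^sup>2"
  shows "\<exists>\<xi> :: nat \<Rightarrow> real. \<forall>i < s div 2. 0 < \<xi> i \<and> \<xi> i < 1/4 \<and> D (\<xi> i) (\<xi> (i - 1)) +
     (if Suc i < s div 2 then D (\<xi> i) (\<xi> (Suc i)) else if even s then D (\<xi> i) (- \<xi> i) else D (\<xi> i) 0) = 0"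
proof -
  define m where "m = s div 2"
  \<comment> \<open>\<open>Re (\<delta>1 u)\<close> extends \<open>D u (- u)\<close> continuously to \<open>u = 1/4\<close>, where the chord degenerates.\<close>
  define e where "e u = (if even s then Re (\<delta>1 u) else D u 0)" for u
  \<comment> \<open>A real argument gives meaning to \<open>C (-1)\<close>, the true left neighbour
    of index 0; its equality with \<open>C 0\<close> matches the truncated subtraction.\<close>
  define C :: "real \<Rightarrow> real" where "C x = cos (pi * (2 * x + 1) / (2 * s))" for x
  have C_pos: "0 < C (real i)" if "i < m" for i
  proof -
    have "2 * i + 1 < s" using that by (simp add: m_def)
    then have "real (2 * i + 1) < real s" by (simp only: of_nat_less_iff)
    then have "pi * (2 * real i + 1) / (2 * s) < pi / 2"
      using s by (simp add: pos_divide_less_eq)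
    moreover have "0 \<le> pi * (2 * real i + 1) / (2 * s)" by simp
    ultimately show ?thesis unfolding C_def by (intro cos_gt_zero_pi) linarith+
  qed
  have C_le: "C x \<le> 1" for x by (simp add: C_def)
  have C_left: "C (real i - 1) = C (real (i - 1))" for i
  proof (cases i)
    case 0
    have "C (-1) = cos (- (pi / (2 * s)))" by (simp add: C_def)
    also have "\<dots> = C 0" by (simp only: cos_minus) (simp add: C_def)
    finally show ?thesis using 0 by simp
  qed simp
  \<comment> \<open>The cosine also meets the right-hand boundary condition, being antisymmetric
    about its zero at \<open>x = (s - 1) / 2\<close>.\<close>
  have C_mid: "C (real i + 1) = (if even s then - C (real i) else 0)" if "Suc i = m" for i
  proof (cases "even s")
    case True
    then have "s = 2 * i + 2" using that by (auto simp: m_def)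
    then have "C (real i + 1) = - C (real i) \<longleftrightarrow>
       cos (pi / 2 + pi / (4 * real i + 4)) = - cos (pi / 2 - pi / (4 * real i + 4))"
      by (auto simp: C_def field_simps intro!: arg_cong2[where f="(=)"] arg_cong[where f=cos])
    then show ?thesis using True by (simp add: cos_add cos_diff)
  next
    case False
    then have "s = 2 * i + 3" using that by (auto simp: m_def elim!: oddE)
    then have "pi * (2 * (real i + 1) + 1) / (2 * s) = pi / 2" by (simp add: field_simps)
    then show ?thesis using False unfolding C_def by (simp only: cos_pi_half if_False)
  qed
  \<comment> \<open>\<open>C\<close> is an eigenvector of the neighbour sum, so the linearised
    expression is a multiple of \<open>C\<close> itself.\<close>
  have C_sum: "C (x - 1) + C (x + 1) = 2 * cos (pi / s) * C x" for x
  proof -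
    have "C (x - 1) = cos (pi * (2 * x + 1) / (2 * s) - pi / s)"
         "C (x + 1) = cos (pi * (2 * x + 1) / (2 * s) + pi / s)"
      unfolding C_def using s by (auto intro!: arg_cong[where f=cos] simp: field_simps)
    then show ?thesis by (simp add: C_def cos_add cos_diff)
  qed
  have ev: "\<forall>\<^sub>F t in at_right 0. 0 < D (t * C (real i)) (t * C (real i - 1)) + D (t * C (real i)) (t * C (real i + 1))"
    if i: "i < m" for i
  proof -
    let ?a = "Re (\<delta> 0)" and ?b = "Im (\<delta>1 0)" and ?r = "Re (\<delta>2 0)" and ?x = "real i"
    have "((\<lambda>t. D (t * C ?x) (t * C (?x - 1)) / t + D (t * C ?x) (t * C (?x + 1)) / t) \<longlongrightarrow>
        (C ?x * ?r + (C ?x + C (?x - 1)) * ?b\<^sup>2 / (2 * ?a)) +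
        (C ?x * ?r + (C ?x + C (?x + 1)) * ?b\<^sup>2 / (2 * ?a))) (at_right 0)"
      by (intro tendsto_add filterlim_mono[OF D_limit order_refl at_le]) auto
    moreover have "0 < (C ?x * ?r + (C ?x + C (?x - 1)) * ?b\<^sup>2 / (2 * ?a)) +
        (C ?x * ?r + (C ?x + C (?x + 1)) * ?b\<^sup>2 / (2 * ?a))"
    proof -
      have "0 < 2 * C ?x * (?r * ?a + ?b\<^sup>2 * (cos (pi / (2 * s)))\<^sup>2) / ?a"
        using C_pos[OF i] small pos by simp
      \<comment> \<open>By the half-angle formula, the factor \<open>1 + cos (pi / s)\<close> coming
        from \<open>C_sum\<close> is twice the squared cosine in \<open>small\<close>.\<close>
      also have "(cos (pi / (2 * s)))\<^sup>2 = (1 + cos (pi / s)) / 2"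
        using cos_double_cos[of "pi / (2 * s)"] by simp
      also have "2 * C ?x * (?r * ?a + ?b\<^sup>2 * ((1 + cos (pi / s)) / 2)) / ?a =
          2 * C ?x * ?r + (2 * C ?x + (C (?x - 1) + C (?x + 1))) * ?b\<^sup>2 / (2 * ?a)"
        unfolding C_sum using pos by (simp add: field_simps)
      also have "\<dots> = (C ?x * ?r + (C ?x + C (?x - 1)) * ?b\<^sup>2 / (2 * ?a)) +
          (C ?x * ?r + (C ?x + C (?x + 1)) * ?b\<^sup>2 / (2 * ?a))"
        by (simp add: add_divide_distrib algebra_simps)
      finally show ?thesis .
    qed
    ultimately have "\<forall>\<^sub>F t in at_right 0. 0 < D (t * C ?x) (t * C (?x - 1)) / t + D (t * C ?x) (t * C (?x + 1)) / t"
      by (rule order_tendstoD(1))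
    moreover have "\<forall>\<^sub>F t in at_right 0. (0::real) < t" by (simp add: eventually_at_right_less)
    ultimately show ?thesis
      by eventually_elim (simp add: zero_less_divide_iff flip: add_divide_distrib)
  qed
  have "\<forall>\<^sub>F t in at_right 0. \<forall>i\<in>{..<m}. 0 < D (t * C (real i)) (t * C (real i - 1)) + D (t * C (real i)) (t * C (real i + 1))"
    using ev by (intro eventually_ball_finite) auto
  moreover have "\<forall>\<^sub>F t in at_right 0. (0::real) < t" by (simp add: eventually_at_right_less)
  moreover have "\<forall>\<^sub>F t in at_right 0. t < (1/4::real)"
    by (intro order_tendstoD(2)[of _ 0]) auto
  ultimately have "\<forall>\<^sub>F t in at_right 0. 0 < t \<and> t < 1/4 \<and>
    (\<forall>i\<in>{..<m}. 0 < D (t * C (real i)) (t * C (real i - 1)) + D (t * C (real i)) (t * C (real i + 1)))"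
    by eventually_elim auto
  then obtain t where t: "0 < t" "t < 1/4" and
    sub: "\<And>i. i < m \<Longrightarrow> 0 < D (t * C (real i)) (t * C (real i - 1)) + D (t * C (real i)) (t * C (real i + 1))"
    by (metis (no_types, lifting) eventually_happens' trivial_limit_at_right_real lessThan_iff)
  define c where "c i = t * C (real i)" for i :: nat
  have c: "0 < c i" "c i < 1/4" if "i < m" for i
  proof -
    show "0 < c i" using C_pos[OF that] t by (simp add: c_def)
    have "c i \<le> t * 1" unfolding c_def using t C_le by (intro mult_left_mono) auto
    then show "c i < 1/4" using t by simp
  qed
  have e_eq: "e u = (if even s then D u (- u) else D u 0)" if "\<bar>u\<bar> < 1/4" for u
    using D_antidiagonal[OF that] by (simp add: e_def)
  have "\<exists>\<xi>. \<forall>i<m. c i \<le> \<xi> i \<and> \<xi> i < 1/4 \<and>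
     D (\<xi> i) (\<xi> (i - 1)) + (if Suc i < m then D (\<xi> i) (\<xi> (Suc i)) else e (\<xi> i)) = 0"
  proof (rule perron_solution)
    show "D u v \<le> D u v'" if "0 \<le> u" "u \<le> 1/4" "0 \<le> v" "v \<le> v'" "v' \<le> 1/4" for u v v'
    proof (cases "v = v'")
      case False
      then have "v < v'" "\<bar>u - v\<bar> < 1/2" "\<bar>u - v'\<bar> < 1/2" using that by linarith+
      then show ?thesis using D_strict_mono by (simp add: less_imp_le)
    qed simp
    show "D (1/4) v < D (1/4) (1/4)" if "0 \<le> v" "v < 1/4" for v
      using D_strict_mono[of v "1/4" "1/4"] that by auto
    show "D (1/4) (1/4) = 0" by (rule D_quarter)
    show "continuous_on {0..1/4} (\<lambda>u. D u v)" if "0 \<le> v" "v \<le> 1/4" for v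
    proof (rule continuous_D)
      fix u :: real assume "u \<in> {0..1/4}"
      then show "\<bar>u - v\<bar> < 1/2" using that unfolding atLeastAtMost_iff by linarith
    qed
    show "continuous_on {0..1/4} e"
      unfolding e_def by (cases "even s") (auto intro!: continuous_intros continuous_\<delta>1 continuous_D)
    show "e (1/4) < 0"
      using quarter(3) D_strict_mono[of 0 "1/4" "1/4"] D_quarter by (auto simp: e_def)
    show "0 \<le> c i \<and> c i \<le> 1/4" if "i < m" for i
      using c[OF that] by auto
    show "0 \<le> D (c i) (c (i - 1)) + (if Suc i < m then D (c i) (c (Suc i)) else e (c i))" if i: "i < m" for i
    proof -
      have "t * C (real i + 1) = (if even s then - c i else 0)" if "\<not> Suc i < m"
        using C_mid[of i] that i by (auto simp: c_def)
      then show ?thesis using sub[OF i] c[OF i] C_left[of i] e_eq[of "c i"]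
        by (auto simp: c_def add.commute)
    qed
  qed
  then obtain \<xi> where \<xi>: "\<And>i. i < m \<Longrightarrow> c i \<le> \<xi> i \<and> \<xi> i < 1/4 \<and>
     D (\<xi> i) (\<xi> (i - 1)) + (if Suc i < m then D (\<xi> i) (\<xi> (Suc i)) else e (\<xi> i)) = 0" by blast
  \<comment> \<open>The strict bound \<open>\<xi> i < 1/4\<close> is what allows the extension
    \<open>e\<close> to be replaced by \<open>D\<close> again.\<close>
  have "0 < \<xi> i \<and> \<xi> i < 1/4 \<and> D (\<xi> i) (\<xi> (i - 1)) + (if Suc i < m then D (\<xi> i) (\<xi> (Suc i))
     else if even s then D (\<xi> i) (- \<xi> i) else D (\<xi> i) 0) = 0" if "i < m" for i
    using \<xi>[OF that] c[OF that] e_eq[of "\<xi> i"] by auto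
  then show ?thesis unfolding m_def by blast
qed

text \<open>The quarter profile is extended by its symmetries. The residual of the recurrence
  inherits them up to sign, so its vanishing at the first \<open>s div 2\<close> indices spreads to
  all integers.\<close>

lemma exists_profile:
  fixes s :: int
  assumes s: "2 \<le> s"
    and small: "- Re (\<delta>2 0) * Re (\<delta> 0) < (Im (\<delta>1 0))\<^sup>2 * (cos (pi / (2 * s)))\<^sup>2"
  obtains \<xi> :: "int \<Rightarrow> real"
  where "\<And>i. \<xi> (i + s) = - \<xi> i" "\<And>i. \<xi> (- 1 - i) = \<xi> i" "\<And>i. \<bar>\<xi> i\<bar> < 1/4"
    "\<And>i. 0 \<le> i \<Longrightarrow> 2 * i + 1 < s \<Longrightarrow> 0 < \<xi> i"
    "\<And>i. D (\<xi> i) (\<xi> (i - 1)) + D (\<xi> i) (\<xi> (i + 1)) = 0"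
proof -
  define m where "m = nat s div 2"
  have less_m: "i < m \<longleftrightarrow> 2 * int i + 1 < s" for i
  proof -
    have "i < n div 2 \<longleftrightarrow> 2 * i + 1 < n" for n :: nat by linarith
    then show ?thesis using s unfolding m_def by linarith
  qed
  have ex: "\<exists>x :: nat \<Rightarrow> real. \<forall>i < nat s div 2. 0 < x i \<and> x i < 1/4 \<and> D (x i) (x (i - 1)) +
     (if Suc i < nat s div 2 then D (x i) (x (Suc i)) else if even (nat s) then D (x i) (- x i) else D (x i) 0) = 0"
    by (rule exists_half_profile) (use s small in auto)
  have even_s: "even (nat s) \<longleftrightarrow> even s" using s by (simp add: even_nat_iff)
  obtain x :: "nat \<Rightarrow> real" where x: "\<And>i. i < m \<Longrightarrow> 0 < x i \<and> x i < 1/4 \<and> D (x i) (x (i - 1)) +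
     (if Suc i < m then D (x i) (x (Suc i)) else if even s then D (x i) (- x i) else D (x i) 0) = 0"
    using ex unfolding m_def even_s by blast
  \<comment> \<open>On a half period the extension is odd about \<open>(s - 1) / 2\<close>; the
    value 0 occurs only at the middle index, for odd \<open>s\<close>.\<close>
  define \<eta> where "\<eta> j = (if 2 * j + 1 < s then x (nat j) else if s < 2 * j + 1 then - x (nat (s - 1 - j)) else 0)" for j
  define \<xi> where "\<xi> i = (if even (i div s) then \<eta> (i mod s) else - \<eta> (i mod s))" for i
  have shift: "\<xi> (i + s) = - \<xi> i" for i
    using s by (simp add: \<xi>_def)
  have \<eta>_flip: "\<eta> (s - 1 - j) = - \<eta> j" for j
    by (simp add: \<eta>_def)
  \<comment> \<open>The flip changes the parity of the quotient and reflects the remainder; the two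
    resulting signs cancel.\<close>
  have flip: "\<xi> (- 1 - i) = \<xi> i" for i
  proof -
    have "(- 1 - i) div s = - 1 - i div s" "(- 1 - i) mod s = s - 1 - i mod s"
    proof -
      have "- 1 - i = s * (- 1 - i div s) + (s - 1 - i mod s)"
        using mult_div_mod_eq[of s i] by (simp add: algebra_simps)
      moreover have "0 \<le> s - 1 - i mod s" "s - 1 - i mod s < s"
        using pos_mod_bound[of s i] pos_mod_sign[of s i] s by linarith+
      ultimately show "(- 1 - i) div s = - 1 - i div s" "(- 1 - i) mod s = s - 1 - i mod s"
        using s by (metis div_mult_self4 add_0 div_pos_pos_trivial add.commute int_div_pos_eq, metis int_mod_pos_eq)
    qed
    then show ?thesis by (simp add: \<xi>_def \<eta>_flip)
  qed
  have \<xi>_x: "\<xi> (int i) = x i" if "i < m" for i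
  proof -
    have "2 * int i + 1 < s" using that by (simp add: less_m)
    then show ?thesis by (simp add: \<xi>_def \<eta>_def)
  qed
  have \<eta>_bound: "\<bar>\<eta> j\<bar> < 1/4" if "0 \<le> j" "j < s" for j
  proof -
    have "nat j < m" if "2 * j + 1 < s" using that \<open>0 \<le> j\<close> by (simp add: less_m)
    moreover have "nat (s - 1 - j) < m" if "s < 2 * j + 1" using that \<open>j < s\<close> by (simp add: less_m)
    moreover have "\<bar>x i\<bar> < 1/4" if "i < m" for i using x[OF that] by linarith
    ultimately show ?thesis by (simp add: \<eta>_def)
  qed
  have bound: "\<bar>\<xi> i\<bar> < 1/4" for i
    using \<eta>_bound[of "i mod s"] s by (simp add: \<xi>_def)
  have posi: "0 < \<xi> i" if "0 \<le> i" "2 * i + 1 < s" for i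
  proof -
    have "nat i < m" using that by (simp add: less_m)
    then show ?thesis using \<xi>_x[of "nat i"] x[of "nat i"] that by simp
  qed
  define E where "E i = D (\<xi> i) (\<xi> (i - 1)) + D (\<xi> i) (\<xi> (i + 1))" for i
  have E_shift: "E (i + s) = - E i" for i
  proof -
    have "\<xi> (i + s - 1) = - \<xi> (i - 1)" "\<xi> (i + s + 1) = - \<xi> (i + 1)"
      using shift[of "i - 1"] shift[of "i + 1"] by (simp_all add: algebra_simps)
    then show ?thesis by (simp add: E_def shift D_minus)
  qed
  have E_flip: "E (- 1 - i) = E i" for i
    using flip[of "i - 1"] flip[of "i + 1"] by (simp add: E_def flip algebra_simps)
  have E_low: "E (int i) = 0" if i: "i < m" for i
  proof -
    have "\<xi> (int i - 1) = x (i - 1)"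
    proof (cases i)
      case 0
      then show ?thesis using flip[of 0] \<xi>_x[of 0] i by simp
    next
      case (Suc k)
      then show ?thesis using \<xi>_x[of k] i by simp
    qed
    moreover have "\<xi> (int i + 1) = (if Suc i < m then x (Suc i) else if even s then - x i else 0)"
    proof (cases "Suc i < m")
      case True
      then show ?thesis using \<xi>_x[of "Suc i"] by (simp add: add.commute)
    next
      case False
      then have m: "m = Suc i" "2 * int i + 1 < s" "s \<le> 2 * int i + 3"
        using i less_m[of i] less_m[of "Suc i"] by auto
      show ?thesis
      proof (cases "even s")
        case True
        then have "s = 2 * int i + 2" using m(2,3) by presburger
        then show ?thesis using True m s by (simp add: \<xi>_def \<eta>_def)
      next
        case False
        then have "s = 2 * int i + 3" using m(2,3) by presburger
        then show ?thesis using False m s by (simp add: \<xi>_def \<eta>_def)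
      qed
    qed
    ultimately show ?thesis using x[OF i] \<xi>_x[OF i] by (auto simp: E_def split: if_splits)
  qed
  have E_refl: "E (s - 1 - i) = - E i" for i
    using E_shift[of "-1 - i"] E_flip[of i] by (simp add: algebra_simps)
  have E_base: "E j = 0" if "0 \<le> j" "j < s" for j
  proof -
    consider "2 * j + 1 < s" | "2 * j + 1 = s" | "s < 2 * j + 1" by linarith
    then show ?thesis
    proof cases
      case 1
      then have "nat j < m" using that by (simp add: less_m)
      then show ?thesis using E_low[of "nat j"] that by simp
    next
      case 2
      \<comment> \<open>The reflection fixes the middle index, so the residual there equals its own
        negative.\<close>
      then have "s - 1 - j = j" by simp
      then show ?thesis using E_refl[of j] by simp
    next
      case 3
      then have "nat (s - 1 - j) < m" using that by (simp add: less_m)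
      then show ?thesis using E_low[of "nat (s - 1 - j)"] E_refl[of j] that by simp
    qed
  qed
  have E_mult: "E (i + s * int n) = 0 \<longleftrightarrow> E i = 0" for i n
  proof (induction n)
    case (Suc n)
    then show ?case using E_shift[of "i + s * int n"] by (simp add: algebra_simps)
  qed simp
  have "E i = 0" for i
  proof (cases "0 \<le> i div s")
    case True
    then show ?thesis
      using E_mult[of "i mod s" "nat (i div s)"] E_base[of "i mod s"] s by simp
  next
    case False
    then have "i + s * int (nat (- (i div s))) = i mod s"
      by (simp add: minus_mult_div_eq_mod[symmetric] algebra_simps)
    then show ?thesis
      using E_mult[of i "nat (- (i div s))"] E_base[of "i mod s"] s by simp
  qed
  then show ?thesis using that[of \<xi>] shift flip bound posi by (auto simp: E_def)
qed
end

section \<open>Combinatorics of a half wave\<close>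

text \<open>The flip is centred at \<open>-1/2\<close>, so \<open>2 * i + 1\<close> is twice the
  offset of \<open>i\<close> from the centre. Over a period \<open>2 * s\<close> the wave is
  positive around \<open>-1/2\<close>, negative around \<open>s - 1/2\<close>, and for odd
  \<open>s\<close> zero at two indices in between.\<close>

locale half_wave =
  fixes \<xi> :: "int \<Rightarrow> real" and s :: int
  assumes s: "2 \<le> s" and shift: "\<xi> (i + s) = - \<xi> i" and flip: "\<xi> (- 1 - i) = \<xi> i"
    and pos: "\<lbrakk>0 \<le> i; 2 * i + 1 < s\<rbrakk> \<Longrightarrow> 0 < \<xi> i"
begin

lemma wave_pos: "\<bar>2 * i + 1\<bar> < s \<Longrightarrow> 0 < \<xi> i"
  using pos[of i] pos[of "-1 - i"] flip[of i] by (cases "0 \<le> i") auto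

lemma wave_neg: "\<bar>2 * i + 1 - 2 * s\<bar> < s \<Longrightarrow> \<xi> i < 0"
  using wave_pos[of "i - s"] shift[of "i - s"] by (simp add: algebra_simps)

lemma wave_zero:
  assumes "2 * i + 1 = s \<or> 2 * i + 1 = 3 * s"
  shows "\<xi> i = 0"
proof -
  have zero: "\<xi> j = 0" if "2 * j + 1 = s" for j
  proof -
    have "- 1 - j + s = j" using that by simp
    then have "\<xi> j = - \<xi> (- 1 - j)" using shift[of "- 1 - j"] by (simp only:)
    then show ?thesis using flip[of j] by simp
  qed
  show ?thesis
    using assms zero[of i] zero[of "i - s"] shift[of "i - s"] by auto
qed

lemma wave_periodic: "\<xi> (i + 2 * s) = \<xi> i"
  using shift[of i] shift[of "i + s"] by (simp add: algebra_simps)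

text \<open>Let \<open>j\<close> be the last index of the positive stretch. The \<open>s\<close>
  values after it are at most 0, whereas both \<open>k\<close> and \<open>2 * s - k\<close> would be
  periods and one of them is at most \<open>s\<close>.\<close>

lemma no_smaller_period:
  assumes k: "0 < k" "k < 2 * s"
  shows "\<exists>i. \<xi> (i + k) \<noteq> \<xi> i"
proof (rule ccontr)
  assume "\<nexists>i. \<xi> (i + k) \<noteq> \<xi> i"
  then have per: "\<xi> (i + k) = \<xi> i" for i by blast
  define j where "j = s div 2 - 1"
  have j: "s - 2 \<le> 2 * j + 1" "2 * j + 1 < s" "0 \<le> j"
    using s unfolding j_def by presburger+
  have *: "\<xi> (j + l) \<le> 0" if l: "0 < l" "l \<le> s" for l
  proof -
    have "2 * (j + l) + 1 = s \<or> s < 2 * (j + l) + 1 \<and> 2 * (j + l) + 1 < 3 * s"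
      using l j by presburger
    then consider "2 * (j + l) + 1 = s" | "\<bar>2 * (j + l) + 1 - 2 * s\<bar> < s"
      by linarith
    then show ?thesis using wave_zero[of "j + l"] wave_neg[of "j + l"] by cases simp_all
  qed
  have "\<xi> (j + l) = \<xi> j" if "l = k \<or> l = 2 * s - k" for l
    using per[of j] per[of "j + (2 * s - k)"] wave_periodic[of j] that by auto
  then show False
    using *[of k] *[of "2 * s - k"] pos[OF j(3,2)] k by (cases "k \<le> s") fastforce+
qed

text \<open>A periodic sequence monotone along steps of 2 is constant along them, giving the period
  2, which is less than \<open>2 * s\<close>. The Birkhoff property is later reduced to such
  monotonicity.\<close>

lemma not_monotone:
  assumes "(\<forall>i. \<xi> i \<le> \<xi> (i + 2)) \<or> (\<forall>i. \<xi> (i + 2) \<le> \<xi> i)"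
  shows False
proof -
  have eq: "f (i + 2) = f i" if "\<And>i. f i \<le> f (i + 2)" "\<And>i. f (i + 2 * s) = f i" for f :: "int \<Rightarrow> real" and i
  proof -
    have "f j \<le> f (j + 2 * int n)" for j n
    proof (induction n)
      case (Suc n)
      then show ?case using that(1)[of "j + 2 * int n"] by (simp add: algebra_simps)
    qed simp
    from this[of "i + 2" "nat (s - 1)"] show ?thesis
      using that(1)[of i] that(2)[of i] s by (simp add: algebra_simps)
  qed
  have "\<xi> (i + 2) = \<xi> i" for i
    using assms eq[of \<xi> i] eq[of "\<lambda>i. - \<xi> i" i] wave_periodic by auto
  then show False using no_smaller_period[of 2] s by auto
qed

text \<open>Without zeros, one period consists of \<open>m\<close> positive, \<open>2 * m\<close>
  negative and \<open>m\<close> positive values. The cyclic pair of last and first value is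
  positive, so only the two block boundaries count.\<close>

lemma sign_changes_eq_2: "sign_changes (2 * s) \<xi> = 2"
proof -
  define m where "m = nat s div 2"
  have m: "2 * int m = s \<or> 2 * int m + 1 = s" "1 \<le> m"
    using s unfolding m_def by linarith+
  define P N Q where "P = map \<xi> [0..int m - 1]" and "N = map \<xi> [s - int m..s + int m - 1]"
    and "Q = map \<xi> [2 * s - int m..2 * s - 1]"
  have len: "length P = m" "length N = 2 * m" "length Q = m"
    using m by (auto simp: P_def N_def Q_def)
  have P: "\<forall>v\<in>set P. 0 < v"
    using m by (auto simp: P_def intro!: wave_pos)
  have N: "\<forall>v\<in>set N. v < 0"
    using m by (auto simp: N_def intro!: wave_neg)
  have Q: "\<forall>v\<in>set Q. 0 < v"
  proof -
    have "0 < \<xi> i" if "2 * s - int m \<le> i" "i \<le> 2 * s - 1" for i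
      using wave_pos[of "i - 2 * s"] wave_periodic[of "i - 2 * s"] that m by auto
    then show ?thesis by (auto simp: Q_def)
  qed
  \<comment> \<open>These gaps are empty for even \<open>s\<close>; for odd \<open>s\<close> each is
    a single index where the wave vanishes.\<close>
  have Z: "filter (\<lambda>v. v \<noteq> 0) (map \<xi> [int m..s - int m - 1]) = []"
          "filter (\<lambda>v. v \<noteq> 0) (map \<xi> [s + int m..2 * s - int m - 1]) = []"
    using m by (auto simp: filter_empty_conv intro!: wave_zero)
  have split: "[0..2 * s - 1] = [0..int m - 1] @ [int m..s - int m - 1] @ [s - int m..s + int m - 1]
      @ [s + int m..2 * s - int m - 1] @ [2 * s - int m..2 * s - 1]"
  proof -
    have "[0..2 * s - 1] = [0..int m - 1] @ [int m..2 * s - 1]"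
      using m s by (intro upto_split1) linarith+
    also have "[int m..2 * s - 1] = [int m..s - int m - 1] @ [s - int m..2 * s - 1]"
      using m s by (intro upto_split1) linarith+
    also have "[s - int m..2 * s - 1] = [s - int m..s + int m - 1] @ [s + int m..2 * s - 1]"
      using m s by (intro upto_split1) linarith+
    also have "[s + int m..2 * s - 1] = [s + int m..2 * s - int m - 1] @ [2 * s - int m..2 * s - 1]"
      using m s by (intro upto_split1) linarith+
    finally show ?thesis .
  qed
  define L where "L = P @ N @ Q"
  have filt: "filter (\<lambda>v. v \<noteq> 0) P = P" "filter (\<lambda>v. v \<noteq> 0) N = N" "filter (\<lambda>v. v \<noteq> 0) Q = Q"
    using P N Q by (auto simp: filter_id_conv)
  have L: "filter (\<lambda>v. v \<noteq> 0) (map \<xi> [0..2 * s - 1]) = L"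
    unfolding split map_append filter_append Z append_Nil L_def
    using filt by (simp add: P_def N_def Q_def)
  have lenL: "length L = 4 * m" by (simp add: L_def len)
  have sgn: "if j < m \<or> 3 * m \<le> j then 0 < L ! j else L ! j < 0" if "j < 4 * m" for j
    using P N Q that len by (auto simp: L_def nth_append)
  have "j < 4 * m \<and> L ! j * L ! ((j + 1) mod (4 * m)) < 0 \<longleftrightarrow> j = m - 1 \<or> j = 3 * m - 1" for j
  proof (cases "j < 4 * m")
    case True
    show ?thesis
    proof (cases "j = 4 * m - 1")
      case True
      then have "(j + 1) mod (4 * m) = 0" using m by simp
      moreover have "3 * m \<le> j" "j < 4 * m" "j \<noteq> m - 1" "j \<noteq> 3 * m - 1" using True m by auto
      ultimately show ?thesis using sgn[of j] sgn[of 0] m by (auto simp: mult_less_0_iff)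
    next
      case False
      then have "j + 1 < 4 * m" using True by simp
      moreover from this have "(j + 1) mod (4 * m) = j + 1" by simp
      ultimately show ?thesis using sgn[of j] sgn[of "j + 1"] m
        by (auto simp: mult_less_0_iff split: if_splits)
    qed
  qed (use m in auto)
  then have "{j. j < length L \<and> L ! j * L ! ((j + 1) mod length L) < 0} = {m - 1, 3 * m - 1}"
    by (auto simp: lenL)
  then show ?thesis
    unfolding sign_changes_def Let_def L using m by simp
qed

end

section \<open>Convexity and orientation of billiard curves\<close>

lemma C2_derivatives:
  assumes "C2 \<gamma>"
  shows "(\<gamma> has_vector_derivative d1 \<gamma> t) (at t)" "(d1 \<gamma> has_vector_derivative d2 \<gamma> t) (at t)"
    "continuous_on S (d1 \<gamma>)"
proof -
  obtain g1 g2 where g: "\<And>t. (\<gamma> has_vector_derivative g1 t) (at t)" "\<And>t. (g1 has_vector_derivative g2 t) (at t)"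
    using assms unfolding C2_def by blast
  have "d1 \<gamma> = g1" using g(1) by (auto simp: d1_def vector_derivative_at)
  moreover have "d2 \<gamma> = g2" unfolding d2_def \<open>d1 \<gamma> = g1\<close> using g(2) by (auto simp: vector_derivative_at)
  ultimately show "(\<gamma> has_vector_derivative d1 \<gamma> t) (at t)" "(d1 \<gamma> has_vector_derivative d2 \<gamma> t) (at t)"
      "continuous_on S (d1 \<gamma>)"
    using g by (auto intro!: continuous_at_imp_continuous_on has_vector_derivative_continuous)
qed

section \<open>Translation of the parameter and rotation of the plane\<close>

lemma has_vector_derivative_translate:
  fixes f :: "real \<Rightarrow> complex"
  assumes "(f has_vector_derivative D) (at (c + t))"
  shows "((\<lambda>t. f (c + t)) has_vector_derivative D) (at t)"
proof -
  have "((\<lambda>t. c + t) has_vector_derivative (1::real)) (at t)"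
    by (auto intro!: derivative_eq_intros)
  from vector_diff_chain_at[OF this, of f D] assms show ?thesis by (simp add: o_def)
qed

lemma unit_cnj_mult:
  assumes "cmod c = 1"
  shows "cnj (c * a) * (c * b) = cnj a * b"
proof -
  have "cnj c * c = 1" using assms complex_norm_square[of c] by (simp add: mult.commute)
  then show ?thesis by (simp add: mult.assoc mult.left_commute[of _ c] flip: mult.assoc)
qed

text \<open>This treats one summand of the reflection law: tangent and chord share the unit factor
  \<open>c\<close>, which cancels.\<close>

lemma inner_rotate_direction:
  assumes "cmod c = 1"
  shows "inner (c * a) (- (c * b) / of_real (cmod (- (c * b)))) = - (inner a b / cmod b)"
proof -
  have "inner (c * a) (c * b) = inner a b"
  proof -
    have re: "inner x y = Re (cnj x * y)" for x y by (simp add: inner_complex_def)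
    show ?thesis unfolding re unit_cnj_mult[OF assms] ..
  qed
  moreover have "- (c * b) / of_real (cmod (- (c * b))) = (- 1 / cmod b) *\<^sub>R (c * b)"
    using assms by (simp add: norm_mult scaleR_conv_of_real)
  ultimately show ?thesis by (simp only: inner_scaleR_right) simp
qed

locale billiard =
  fixes \<gamma> :: "real \<Rightarrow> complex"
  assumes curve: "billiard_curve \<gamma>" and equiv: "D2_equivariant \<gamma>"
begin

lemma deriv: "(\<gamma> has_vector_derivative d1 \<gamma> t) (at t)" "(d1 \<gamma> has_vector_derivative d2 \<gamma> t) (at t)"
  "continuous_on S (d1 \<gamma>)" "continuous_on S \<gamma>"
  using curve C2_derivatives unfolding billiard_curve_def
  by (auto intro!: continuous_at_imp_continuous_on has_vector_derivative_continuous)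

lemma half: "\<gamma> (t + 1/2) = - \<gamma> t" and reflect: "\<gamma> (- t) = cnj (\<gamma> t)"
  using equiv by (auto simp: D2_equivariant_def Rrot_def Sref_def)

lemma periodic: "\<gamma> (t + of_int n) = \<gamma> t"
proof -
  have 1: "\<gamma> (t + 1) = \<gamma> t" for t using curve by (simp add: billiard_curve_def)
  have nat: "\<gamma> (t + real k) = \<gamma> t" for k t
  proof (induction k)
    case (Suc k)
    then show ?case using 1[of "t + real k"] by (simp add: algebra_simps)
  qed simp
  show ?thesis
  proof (cases "0 \<le> n")
    case True
    then show ?thesis using nat[of t "nat n"] by simp
  next
    case False
    then show ?thesis using nat[of "t + of_int n" "nat (- n)"] by simp
  qed
qed

lemma frac: "\<gamma> (frac t) = \<gamma> t"
  using periodic[of "frac t" "\<lfloor>t\<rfloor>"] by (simp add: frac_def)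

lemma eq_iff: "\<gamma> u = \<gamma> v \<longleftrightarrow> u - v \<in> \<int>"
proof
  assume "\<gamma> u = \<gamma> v"
  then have "\<gamma> (frac u) = \<gamma> (frac v)" by (simp add: frac)
  moreover have "inj_on \<gamma> {0..<1}" using curve by (simp add: billiard_curve_def)
  ultimately have "frac u = frac v"
    by (auto simp: frac_lt_1 dest: inj_onD)
  then have "u - v = of_int (\<lfloor>u\<rfloor> - \<lfloor>v\<rfloor>)" by (simp add: frac_def)
  then show "u - v \<in> \<int>" by (metis Ints_of_int)
next
  assume "u - v \<in> \<int>"
  then obtain n where "u = v + of_int n" by (elim Ints_cases) (auto simp: algebra_simps)
  then show "\<gamma> u = \<gamma> v" by (simp add: periodic)
qed

lemma d1_periodic:
  assumes "u - v \<in> \<int>"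
  shows "d1 \<gamma> u = d1 \<gamma> v"
proof -
  obtain n where n: "u = v + of_int n" using assms by (elim Ints_cases) (auto simp: algebra_simps)
  have "((\<lambda>t. \<gamma> (of_int n + t)) has_vector_derivative d1 \<gamma> u) (at v)"
    using has_vector_derivative_translate[of \<gamma> "d1 \<gamma> u" "of_int n" v] deriv(1)[of u] n
    by (simp add: add.commute)
  then have "(\<gamma> has_vector_derivative d1 \<gamma> u) (at v)"
    using periodic by (simp add: add.commute)
  then show ?thesis using deriv(1) vector_derivative_unique_at by blast
qed

lemma d_half: "d1 \<gamma> (t + 1/2) = - d1 \<gamma> t" "d2 \<gamma> (t + 1/2) = - d2 \<gamma> t"
proof -
  have 1: "d1 \<gamma> (t + 1/2) = - d1 \<gamma> t" for t
  proof -
    have "((\<lambda>s. - \<gamma> (1/2 + s)) has_vector_derivative - d1 \<gamma> (t + 1/2)) (at t)"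
      using has_vector_derivative_translate[of \<gamma> _ "1/2" t] deriv(1)[of "t + 1/2"]
      by (intro has_vector_derivative_minus) (simp add: add.commute)
    then have "(\<gamma> has_vector_derivative - d1 \<gamma> (t + 1/2)) (at t)"
      using half by (simp add: add.commute)
    then have "d1 \<gamma> t = - d1 \<gamma> (t + 1/2)" using deriv(1) vector_derivative_unique_at by blast
    then show ?thesis by simp
  qed
  have "((\<lambda>s. - d1 \<gamma> (1/2 + s)) has_vector_derivative - d2 \<gamma> (t + 1/2)) (at t)"
    using has_vector_derivative_translate[of "d1 \<gamma>" _ "1/2" t] deriv(2)[of "t + 1/2"]
    by (intro has_vector_derivative_minus) (simp add: add.commute)
  then have "(d1 \<gamma> has_vector_derivative - d2 \<gamma> (t + 1/2)) (at t)"
    using 1 by (simp add: add.commute)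
  then have "d2 \<gamma> t = - d2 \<gamma> (t + 1/2)" using deriv(2) vector_derivative_unique_at by blast
  then show "d1 \<gamma> (t + 1/2) = - d1 \<gamma> t" "d2 \<gamma> (t + 1/2) = - d2 \<gamma> t" using 1 by auto
qed

lemma nonzero: "\<gamma> t \<noteq> 0" and d1_nonzero: "d1 \<gamma> t \<noteq> 0"
proof -
  show "d1 \<gamma> t \<noteq> 0" using curve by (simp add: billiard_curve_def)
  show "\<gamma> t \<noteq> 0"
  proof
    assume "\<gamma> t = 0"
    then have "\<gamma> (t + 1/2) = \<gamma> t" by (simp add: half)
    then obtain n where "(1/2::real) = of_int n" by (auto simp: eq_iff elim: Ints_cases)
    then have "0 < real_of_int n" "real_of_int n < 1" by linarith+
    then show False by simp
  qed
qed

lemma ne_half: "\<gamma> t \<noteq> \<gamma> (t + 1/2)"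
  unfolding half using nonzero[of t] by (simp add: eq_neg_iff_add_eq_0 flip: mult_2)

lemma in_curve: "\<gamma> t \<in> Defs.curve \<gamma>"
proof -
  have "\<gamma> t = \<gamma> (frac t)" "frac t \<in> {0..1}"
    by (auto simp: frac less_imp_le[OF frac_lt_1])
  then show ?thesis unfolding curve_def by blast
qed

text \<open>A supporting functional at \<open>\<gamma> u\<close> is minimal there along the curve,
  so its line is the tangent. If \<open>\<gamma> v\<close> lay on it, so would the midpoint of the
  chord; but strict convexity puts the midpoint in the interior, where the functional is
  larger.\<close>

lemma cross_nonzero:
  assumes "u - v \<notin> \<int>"
  shows "Im (cnj (d1 \<gamma> u) * (\<gamma> v - \<gamma> u)) \<noteq> 0"
proof
  assume 0: "Im (cnj (d1 \<gamma> u) * (\<gamma> v - \<gamma> u)) = 0"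
  obtain K where K: "compact K" "convex K" "interior K \<noteq> {}" "frontier K = Defs.curve \<gamma>"
    and strict: "\<And>a b. a \<in> K \<Longrightarrow> b \<in> K \<Longrightarrow> a \<noteq> b \<Longrightarrow> open_segment a b \<subseteq> interior K"
    using curve unfolding billiard_curve_def by blast
  have fr: "\<gamma> t \<in> frontier K" for t using in_curve K(4) by simp
  have inK: "\<gamma> t \<in> K" for t
    using fr[of t] K(1) by (auto simp: frontier_def compact_imp_closed)
  have ri: "rel_interior K = interior K" using K(3) by (rule rel_interior_nonempty_interior)
  have "\<gamma> u \<notin> rel_interior K" using fr[of u] by (simp add: ri frontier_def)
  then obtain a where a: "a \<noteq> 0" "\<And>y. y \<in> K \<Longrightarrow> inner a (\<gamma> u) \<le> inner a y"
      "\<And>y. y \<in> interior K \<Longrightarrow> inner a (\<gamma> u) < inner a y"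
    using supporting_hyperplane_rel_boundary[OF K(2) inK[of u]] ri by metis
  have "((\<lambda>t. inner a (\<gamma> t)) has_real_derivative inner a (d1 \<gamma> u)) (at u)"
    using bounded_linear.has_vector_derivative[OF bounded_linear_inner_right deriv(1)]
    by (simp add: has_real_derivative_iff_has_vector_derivative)
  then have tangent: "inner a (d1 \<gamma> u) = 0"
    by (rule DERIV_local_min[of _ _ _ 1]) (use a(2) inK in auto)
  have "\<gamma> u \<noteq> \<gamma> v" using assms eq_iff by blast
  then have "midpoint (\<gamma> u) (\<gamma> v) \<in> interior K"
    using strict[OF inK[of u] inK[of v]] midpoint_in_open_segment by blast
  from a(3)[OF this] have pos: "0 < inner a (\<gamma> v - \<gamma> u)"
    by (simp add: midpoint_def inner_add_right inner_diff_right)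
  have "\<gamma> v - \<gamma> u = (cnj (d1 \<gamma> u) * (\<gamma> v - \<gamma> u)) * d1 \<gamma> u / of_real ((cmod (d1 \<gamma> u))\<^sup>2)"
    unfolding complex_norm_square using d1_nonzero[of u] by (simp add: field_simps)
  also have "\<dots> = (Re (cnj (d1 \<gamma> u) * (\<gamma> v - \<gamma> u)) / (cmod (d1 \<gamma> u))\<^sup>2) *\<^sub>R d1 \<gamma> u"
    using 0 by (simp add: complex_eq_iff)
  finally have "inner a (\<gamma> v - \<gamma> u) = 0"
    using tangent by (metis inner_scaleR_right mult_zero_right)
  then show False using pos by simp
qed

text \<open>The chord to the antipode is \<open>-2 * \<gamma> u\<close>, so the sign is that of the
  angular velocity about the origin. It cannot change along the curve, and the winding number
  excludes the negative one.\<close>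

lemma cross_half_pos: "0 < Im (cnj (d1 \<gamma> u) * (\<gamma> (u + 1/2) - \<gamma> u))"
proof (rule ccontr)
  define g where "g t = Im (cnj (d1 \<gamma> t) * (\<gamma> (t + 1/2) - \<gamma> t))" for t
  assume not_pos: "\<not> 0 < Im (cnj (d1 \<gamma> u) * (\<gamma> (u + 1/2) - \<gamma> u))"
  have nz: "g t \<noteq> 0" for t
  proof -
    have "t - (t + 1/2) \<notin> \<int>"
      using ne_half eq_iff by blast
    then show ?thesis unfolding g_def by (rule cross_nonzero)
  qed
  have neg: "0 < - g t" for t
  proof (rule pos_of_connected[of UNIV "\<lambda>t. - g t" u])
    show "continuous_on UNIV (\<lambda>t. - g t)"
      unfolding g_def half by (intro continuous_intros deriv)
    show "0 < - g u" using not_pos nz[of u] unfolding g_def by linarith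
  qed (use nz in auto)
  obtain K where K: "compact K" "frontier K = Defs.curve \<gamma>"
    and strict: "\<And>a b. a \<in> K \<Longrightarrow> b \<in> K \<Longrightarrow> a \<noteq> b \<Longrightarrow> open_segment a b \<subseteq> interior K"
    and wn: "\<And>w. w \<in> interior K \<Longrightarrow> winding_number \<gamma> w = 1"
    using curve unfolding billiard_curve_def by blast
  have inK: "\<gamma> t \<in> K" for t
    using in_curve[of t] K by (metis compact_imp_closed frontier_subset_closed subsetD)
  \<comment> \<open>The origin is the midpoint of a chord between antipodes and hence interior,
    which makes the winding number known there.\<close>
  have "midpoint (\<gamma> 0) (\<gamma> (0 + 1/2)) \<in> interior K"
    using strict[OF inK[of 0] inK[of "0 + 1/2"]] midpoint_in_open_segment ne_half[of 0] by blast
  then have w1: "winding_number \<gamma> 0 = 1"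
    using wn half[of 0] by (simp add: midpoint_def)
  have vp: "valid_path \<gamma>"
    unfolding valid_path_def
    by (intro C1_differentiable_imp_piecewise) (auto simp: C1_differentiable_on_def intro!: exI[of _ "d1 \<gamma>"] deriv)
  \<comment> \<open>If the sign were wrong, the reversed curve would wind nonnegatively around the centre.\<close>
  have "0 \<le> Re (winding_number (reversepath \<gamma>) 0)"
  proof (rule winding_number_pos_le)
    show "valid_path (reversepath \<gamma>)" using vp by simp
    show "0 \<notin> path_image (reversepath \<gamma>)" using nonzero by (subst path_image_reversepath) (force simp: path_image_def)
    fix x :: real assume "0 < x" "x < 1"
    have "((\<lambda>t. 1 - t) has_vector_derivative (-1::real)) (at x)"
      by (auto intro!: derivative_eq_intros)
    from vector_diff_chain_at[OF this, of \<gamma> "d1 \<gamma> (1 - x)"] deriv(1)[of "1 - x"]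
    have "(reversepath \<gamma> has_vector_derivative - d1 \<gamma> (1 - x)) (at x)"
      by (simp add: o_def reversepath_def)
    then have vd: "vector_derivative (reversepath \<gamma>) (at x) = - d1 \<gamma> (1 - x)"
      by (rule vector_derivative_at)
    show "0 \<le> Im (vector_derivative (reversepath \<gamma>) (at x) * cnj (reversepath \<gamma> x - 0))"
      using neg[of "1 - x"] unfolding vd g_def half by (simp add: reversepath_def algebra_simps)
  qed
  moreover have "winding_number (reversepath \<gamma>) 0 = - 1"
  proof -
    have "0 \<notin> path_image \<gamma>" using nonzero by (force simp: path_image_def)
    then show ?thesis using winding_number_reversepath[of \<gamma> 0] vp w1 by (simp add: valid_path_imp_path)
  qed
  ultimately show False by simp
qed

text \<open>For fixed \<open>u\<close> the expression has no zero while the second parameter runs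
  from \<open>u\<close> to \<open>u + 1\<close>, so the antipode at \<open>u + 1/2\<close> decides
  its sign.\<close>

lemma cross_pos:
  assumes "u - v \<notin> \<int>"
  shows "0 < Im (cnj (d1 \<gamma> u) * (\<gamma> v - \<gamma> u))"
proof -
  define v' where "v' = u + frac (v - u)"
  have "v - v' = of_int \<lfloor>v - u\<rfloor>" by (simp add: v'_def frac_def)
  then have vv': "\<gamma> v = \<gamma> v'" by (simp add: eq_iff)
  have "v - u \<notin> \<int>" using assms Ints_minus[of "v - u"] by auto
  then have v': "v' \<in> {u<..<u + 1}"
    using frac_lt_1[of "v - u"] frac_gt_0_iff[of "v - u"] by (simp add: v'_def)
  have "0 < Im (cnj (d1 \<gamma> u) * (\<gamma> v' - \<gamma> u))"
  proof (rule pos_of_connected[of "{u<..<u+1}" "\<lambda>x. Im (cnj (d1 \<gamma> u) * (\<gamma> x - \<gamma> u))" "u + 1/2"])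
    show "continuous_on {u<..<u + 1} (\<lambda>x. Im (cnj (d1 \<gamma> u) * (\<gamma> x - \<gamma> u)))"
      by (intro continuous_intros deriv)
    show "Im (cnj (d1 \<gamma> u) * (\<gamma> x - \<gamma> u)) \<noteq> 0" if "x \<in> {u<..<u + 1}" for x
    proof (rule cross_nonzero)
      show "u - x \<notin> \<int>"
      proof
        assume "u - x \<in> \<int>"
        then obtain n where "u - x = of_int n" by (elim Ints_cases)
        then have "real_of_int n < 0" "real_of_int n > -1"
          using that unfolding greaterThanLessThan_iff by linarith+
        then have "n < 0" "n > -1" by linarith+
        then show False by simp
      qed
    qed
  qed (use v' cross_half_pos in auto)
  then show ?thesis by (simp add: vv')
qed

lemma curvature_at_param: "curvature_at \<gamma> (\<gamma> t) = curvature \<gamma> t"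
proof -
  have "(THE s. s \<in> {0..<1} \<and> \<gamma> s = \<gamma> t) = frac t"
  proof (rule the_equality)
    fix s assume s: "s \<in> {0..<1} \<and> \<gamma> s = \<gamma> t"
    then have "\<gamma> s = \<gamma> (frac t)" by (simp add: frac)
    moreover have "inj_on \<gamma> {0..<1}" using curve by (simp add: billiard_curve_def)
    ultimately show "s = frac t" using s by (auto simp: frac_lt_1 dest: inj_onD)
  qed (auto simp: frac frac_lt_1)
  moreover have "d1 \<gamma> (frac t) = d1 \<gamma> t"
    by (rule d1_periodic) (simp add: frac_def)
  moreover have "d2 \<gamma> (frac t) = d2 \<gamma> t"
  proof -
    have "((\<lambda>s. d1 \<gamma> (- of_int \<lfloor>t\<rfloor> + s)) has_vector_derivative d2 \<gamma> (frac t)) (at t)"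
      using has_vector_derivative_translate[of "d1 \<gamma>" _ "- of_int \<lfloor>t\<rfloor>" t] deriv(2)[of "frac t"]
      by (simp add: frac_def)
    moreover have "d1 \<gamma> (- of_int \<lfloor>t\<rfloor> + s) = d1 \<gamma> s" for s
      by (rule d1_periodic) simp
    ultimately have "(d1 \<gamma> has_vector_derivative d2 \<gamma> (frac t)) (at t)" by simp
    then show ?thesis using deriv(2) vector_derivative_unique_at by blast
  qed
  ultimately show ?thesis by (simp add: curvature_at_def curvature_def)
qed

text \<open>Symmetry keeps the images of \<open>Z 0\<close> inside the two-point orbit. As
  \<open>- Z 0\<close> differs from \<open>Z 0\<close>, it must be \<open>Z 1\<close>; then
  \<open>cnj (Z 0)\<close> is one of these two, so the orbit lies on a coordinate axis.\<close>

lemma two_periodic_antipodal: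
  assumes "billiard_sequence \<gamma> Z" "G_symmetric D2 Z" "periodic_with Z 2"
  shows "Z 1 = - Z 0" "cnj (Z 0) = Z 0 \<or> cnj (Z 0) = - Z 0"
    "Z i = (if even i then Z 0 else - Z 0)"
proof -
  have shift: "Z (i + 2 * int n) = Z i" for i n
  proof (induction n)
    case (Suc n)
    have "Z (i + 2 * int n + 2) = Z (i + 2 * int n)"
      using assms(3) unfolding periodic_with_def by blast
    then show ?case using Suc by (simp add: algebra_simps)
  qed simp
  have parity: "Z i = (if even i then Z 0 else Z 1)" for i
  proof -
    have "Z i = Z (i mod 2)"
    proof (cases "0 \<le> i div 2")
      case True
      then show ?thesis using shift[of "i mod 2" "nat (i div 2)"] by simp
    next
      case False
      then have "i + 2 * int (nat (- (i div 2))) = i mod 2" by simp presburger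
      then show ?thesis using shift[of i "nat (- (i div 2))"] by simp
    qed
    then show ?thesis by (cases "even i") (simp_all add: even_iff_mod_2_eq_zero odd_iff_mod_2_eq_one)
  qed
  obtain t where t: "Z 0 = \<gamma> t"
    using assms(1) unfolding billiard_sequence_def curve_def by blast
  have orbit: "\<exists>k. g (Z 0) = Z k" if "g \<in> D2" for g
    using assms(2) that unfolding G_symmetric_def by (metis add_0_right diff_0_right)
  obtain k where "- Z 0 = Z k"
    using orbit[of Rrot] by (auto simp: D2_def Rrot_def)
  moreover have "- Z 0 \<noteq> Z 0" using nonzero[of t] t by (simp add: eq_neg_iff_add_eq_0 flip: mult_2)
  ultimately show Z1: "Z 1 = - Z 0" using parity[of k] by (auto split: if_splits)
  show "Z i = (if even i then Z 0 else - Z 0)" using parity[of i] Z1 by simp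
  obtain l where "cnj (Z 0) = Z l"
    using orbit[of Sref] by (auto simp: D2_def Sref_def)
  then show "cnj (Z 0) = Z 0 \<or> cnj (Z 0) = - Z 0" using parity[of l] Z1 by (auto split: if_splits)
qed

text \<open>Multiplication by \<open>cnj w\<close> turns the axis carrying the orbit into the real
  axis, with the base point on its positive half.\<close>

lemma rotated_symmetric_oval:
  assumes w: "\<gamma> \<tau> = of_real r * w" "0 < r" "cmod w = 1" and sym: "cnj w = w \<or> cnj w = - w"
  shows "symmetric_oval (\<lambda>t. cnj w * \<gamma> (\<tau> + t)) (\<lambda>t. cnj w * d1 \<gamma> (\<tau> + t)) (\<lambda>t. cnj w * d2 \<gamma> (\<tau> + t))"
proof
  have cw: "cmod (cnj w) = 1" "cnj w * w = 1"
    using w(3) complex_norm_square[of w] by (simp_all add: mult.commute)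
  fix t u v :: real
  show "((\<lambda>t. cnj w * \<gamma> (\<tau> + t)) has_vector_derivative cnj w * d1 \<gamma> (\<tau> + t)) (at t)"
    by (intro has_vector_derivative_mult_right has_vector_derivative_translate deriv)
  show "((\<lambda>t. cnj w * d1 \<gamma> (\<tau> + t)) has_vector_derivative cnj w * d2 \<gamma> (\<tau> + t)) (at t)"
    by (intro has_vector_derivative_mult_right has_vector_derivative_translate deriv)
  show "cnj w * \<gamma> (\<tau> + (t + 1/2)) = - (cnj w * \<gamma> (\<tau> + t))"
    using half[of "\<tau> + t"] by (simp add: add.assoc)
  show "cnj w * \<gamma> (\<tau> + - t) = cnj (cnj w * \<gamma> (\<tau> + t))"
    using sym
  proof
    assume cnj: "cnj w = w"
    then have "\<gamma> \<tau> = \<gamma> (- \<tau>)" by (simp add: reflect w)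
    then have "(\<tau> + - t) - (- \<tau> + - t) \<in> \<int>" by (simp add: eq_iff)
    then have "\<gamma> (\<tau> + - t) = \<gamma> (- (\<tau> + t))" by (simp add: eq_iff)
    then show ?thesis using cnj by (simp only: reflect) simp
  next
    \<comment> \<open>Here the orbit lies on the imaginary axis. The reflection fixing its points is
      \<open>Rrot \<circ> Sref\<close>, whence the extra parameter shift \<open>1/2\<close>.\<close>
    assume cnj: "cnj w = - w"
    then have "\<gamma> (\<tau> + 1/2) = \<gamma> (- \<tau>)" by (simp only: reflect half w) simp
    then have "(\<tau> + - t + 1/2) - (- \<tau> + - t) \<in> \<int>" by (simp add: eq_iff algebra_simps)
    then have "\<gamma> (\<tau> + - t + 1/2) = \<gamma> (- (\<tau> + t))" by (simp add: eq_iff)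
    then have "\<gamma> (\<tau> + - t) = - cnj (\<gamma> (\<tau> + t))" by (simp only: half reflect) (metis minus_minus)
    then show ?thesis using cnj by (simp add: complex_cnj_mult)
  qed
  show "0 < Im (cnj (cnj w * d1 \<gamma> (\<tau> + u)) * (cnj w * \<gamma> (\<tau> + v) - cnj w * \<gamma> (\<tau> + u)))"
    if "u - v \<notin> \<int>"
    using unit_cnj_mult[OF cw(1), of "d1 \<gamma> (\<tau> + u)" "\<gamma> (\<tau> + v) - \<gamma> (\<tau> + u)"] cross_pos[of "\<tau> + u" "\<tau> + v"] that
    by (simp add: right_diff_distrib)
  show "0 < Re (cnj w * \<gamma> (\<tau> + 0))"
  proof -
    have "cnj w * \<gamma> (\<tau> + 0) = of_real r * (cnj w * w)" using w(1) by simp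
    then show ?thesis using cw(2) w(2) by simp
  qed
qed

end

section \<open>The orbit of type II\<close>

locale antipodal_orbit = billiard \<gamma> for \<gamma> :: "real \<Rightarrow> complex" +
  fixes \<tau> r :: real and w :: complex
  assumes w: "\<gamma> \<tau> = of_real r * w" "0 < r" "cmod w = 1" and sym: "cnj w = w \<or> cnj w = - w"
begin

definition \<delta> where "\<delta> t = cnj w * \<gamma> (\<tau> + t)"
definition \<delta>1 where "\<delta>1 t = cnj w * d1 \<gamma> (\<tau> + t)"
definition \<delta>2 where "\<delta>2 t = cnj w * d2 \<gamma> (\<tau> + t)"

sublocale oval: symmetric_oval \<delta> \<delta>1 \<delta>2
  using rotated_symmetric_oval[OF w sym] unfolding \<delta>_def \<delta>1_def \<delta>2_def .

definition sg :: "int \<Rightarrow> complex" where "sg i = (if even i then 1 else - 1)"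

text \<open>Curvature is invariant under rotation, and the rotated tangent at the base point is
  vertical, so only the real part of \<open>\<delta>2 0\<close> contributes.\<close>

lemma curvature_base: "curvature_at \<gamma> (\<gamma> \<tau>) = - Re (\<delta>2 0) / (Im (\<delta>1 0))\<^sup>2"
proof -
  have "cmod (cnj w) = 1" using w by simp
  then have "cnj (d1 \<gamma> \<tau>) * d2 \<gamma> \<tau> = cnj (\<delta>1 0) * \<delta>2 0" "cmod (d1 \<gamma> \<tau>) = cmod (\<delta>1 0)"
    using unit_cnj_mult[of "cnj w" "d1 \<gamma> \<tau>" "d2 \<gamma> \<tau>"] by (simp_all add: \<delta>1_def \<delta>2_def norm_mult)
  moreover have "cmod (\<delta>1 0) = Im (\<delta>1 0)"
    using oval.\<delta>1_0 by (simp add: cmod_eq_Im)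
  ultimately show ?thesis
    unfolding curvature_at_param curvature_def using oval.\<delta>1_0
    by (simp add: field_simps power2_eq_square power3_eq_cube)
qed

lemma base_radius: "Re (\<delta> 0) = r"
proof -
  have "cnj w * w = 1" using w(3) complex_norm_square[of w] by (simp add: mult.commute)
  moreover have "\<delta> 0 = of_real r * (cnj w * w)" using w(1) by (simp add: \<delta>_def)
  ultimately show ?thesis by simp
qed

lemma \<gamma>_at: "\<gamma> (\<tau> + of_int i / 2 + u) = w * sg i * \<delta> u" "d1 \<gamma> (\<tau> + of_int i / 2 + u) = w * sg i * \<delta>1 u"
proof -
  have w1: "w * (cnj w * a) = a" for a
    using w(3) complex_norm_square[of w] by (simp flip: mult.assoc)
  have "\<gamma> (\<tau> + of_int i / 2 + u) = sg i * \<gamma> (\<tau> + u) \<and> d1 \<gamma> (\<tau> + of_int i / 2 + u) = sg i * d1 \<gamma> (\<tau> + u)"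
  proof (cases "even i")
    case True
    then obtain k where "i = 2 * k" by (elim evenE)
    then have "(\<tau> + of_int i / 2 + u) - (\<tau> + u) \<in> \<int>" by simp
    then show ?thesis using True d1_periodic eq_iff by (simp add: sg_def)
  next
    case False
    then obtain k where "i = 2 * k + 1" by (elim oddE)
    then have "(\<tau> + of_int i / 2 + u) - (\<tau> + u + 1/2) \<in> \<int>" by (simp add: field_simps)
    then have "\<gamma> (\<tau> + of_int i / 2 + u) = \<gamma> (\<tau> + u + 1/2)" "d1 \<gamma> (\<tau> + of_int i / 2 + u) = d1 \<gamma> (\<tau> + u + 1/2)"
      using d1_periodic eq_iff by blast+
    then show ?thesis using False unfolding half d_half by (simp add: sg_def)
  qed
  then show "\<gamma> (\<tau> + of_int i / 2 + u) = w * sg i * \<delta> u" "d1 \<gamma> (\<tau> + of_int i / 2 + u) = w * sg i * \<delta>1 u"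
    by (simp_all add: \<delta>_def \<delta>1_def mult.assoc w1 mult.left_commute[of "sg i"])
qed

lemma half_integer_lift:
  assumes "\<And>i. Z i = (if even i then \<gamma> \<tau> else - \<gamma> \<tau>)"
  shows "is_lift \<gamma> Z (\<lambda>i. \<tau> + of_int i / 2)"
proof -
  have "\<gamma> (\<tau> + of_int i / 2) = Z i" for i
    using \<gamma>_at(1)[of i 0] \<gamma>_at(1)[of 0 0] assms[of i] by (auto simp: sg_def)
  then show ?thesis by (auto simp: is_lift_def field_simps)
qed

end

locale type_II = antipodal_orbit \<gamma> \<tau> r w + half_wave \<xi> s
  for \<gamma> :: "real \<Rightarrow> complex" and \<tau> r w and \<xi> :: "int \<Rightarrow> real" and s +
  assumes small: "\<bar>\<xi> i\<bar> < 1/4"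
    and balance: "oval.D (\<xi> i) (\<xi> (i - 1)) + oval.D (\<xi> i) (\<xi> (i + 1)) = 0"
begin

definition z where "z i = w * sg i * \<delta> (\<xi> i)"
text \<open>\<open>\<tau> + of_int i / 2\<close> is a lift of the given orbit, so
  \<open>\<xi>\<close> is the displacement whose sign changes are counted.\<close>

definition x where "x i = \<tau> + of_int i / 2 + \<xi> i"

lemma \<gamma>_x: "\<gamma> (x i) = z i"
  by (simp add: x_def z_def \<gamma>_at)

lemma close: "\<bar>\<xi> i - \<xi> j\<bar> < 1/2"
  using small[of i] small[of j] by linarith

lemma lift: "is_lift \<gamma> z x"
proof -
  have "0 < x (i + 1) - x i \<and> x (i + 1) - x i < 1" for i
    using close[of "i + 1" i] unfolding x_def of_int_add of_int_1 add_divide_distrib by linarith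
  then show ?thesis by (simp add: is_lift_def \<gamma>_x)
qed

lemma cmod_w_sg: "cmod (w * sg i) = 1"
  using w(3) by (simp add: norm_mult sg_def)

lemma z_diff: "z (i + 1) - z i = - (w * sg i * (\<delta> (\<xi> i) + \<delta> (\<xi> (i + 1))))"
              "z (i - 1) - z i = - (w * sg i * (\<delta> (\<xi> i) + \<delta> (\<xi> (i - 1))))"
  by (auto simp: z_def sg_def algebra_simps)

lemma orbit: "billiard_orbit \<gamma> z"
  unfolding billiard_orbit_def
proof (intro conjI allI impI)
  show "billiard_sequence \<gamma> z"
    unfolding billiard_sequence_def
  proof (intro allI conjI)
    fix i
    show "z i \<in> Defs.curve \<gamma>" using in_curve[of "x i"] by (simp add: \<gamma>_x)
    have "w * sg i \<noteq> 0" using cmod_w_sg[of i] by force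
    then have "z (i + 1) - z i \<noteq> 0"
      unfolding z_diff using oval.add_nonzero[OF close[of i "i + 1"]] by simp
    then show "z i \<noteq> z (i + 1)" by auto
  qed
  fix i t assume "\<gamma> t = z i"
  then have "t - x i \<in> \<int>" by (simp add: eq_iff flip: \<gamma>_x)
  then have "d1 \<gamma> t = w * sg i * \<delta>1 (\<xi> i)"
    using d1_periodic \<gamma>_at(2) by (simp add: x_def)
  then show "inner (d1 \<gamma> t) ((z (i - 1) - z i) / of_real (cmod (z (i - 1) - z i))) +
      inner (d1 \<gamma> t) ((z (i + 1) - z i) / of_real (cmod (z (i + 1) - z i))) = 0"
    using balance[of i] unfolding z_diff
    by (simp only: inner_rotate_direction[OF cmod_w_sg] oval.D_def)
qed

text \<open>All \<open>\<delta> (\<xi> i)\<close> have positive real part, so equal points have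
  equal signs \<open>sg\<close>. The parameters then agree modulo 1 and differ by less than
  \<open>1/2\<close>.\<close>

lemma z_eq_imp: "z i = z j \<Longrightarrow> \<xi> i = \<xi> j"
proof -
  assume "z i = z j"
  moreover have "w \<noteq> 0" using w(3) by auto
  ultimately have eq: "sg i * \<delta> (\<xi> i) = sg j * \<delta> (\<xi> j)" by (simp add: z_def)
  moreover have "0 < Re (\<delta> (\<xi> i))" "0 < Re (\<delta> (\<xi> j))" using oval.Re_pos small by auto
  ultimately have "sg i = sg j" by (auto simp: sg_def complex_eq_iff split: if_splits)
  then have "\<delta> (\<xi> i) = \<delta> (\<xi> j)" using eq by (auto simp: sg_def split: if_splits)
  then have "\<xi> i - \<xi> j \<in> \<int>" by (rule oval.eq_imp_Ints)
  then obtain n where n: "\<xi> i - \<xi> j = of_int n" by (elim Ints_cases)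
  then have "real_of_int n < 1" "- 1 < real_of_int n" using close[of i j] by linarith+
  then have "n = 0" by linarith
  then show ?thesis using n by simp
qed

section \<open>Minimal period and symmetries of the constructed orbit\<close>

lemma z_periodic: "z (i + 2 * s) = z i"
  by (simp add: z_def sg_def wave_periodic)

lemma no_period: "0 < k \<Longrightarrow> k < 2 * s \<Longrightarrow> \<not> periodic_with z k"
  using no_smaller_period z_eq_imp unfolding periodic_with_def by blast

lemma min_period: "minimal_period z (2 * s)"
  using no_period z_periodic s by (auto simp: minimal_period_def periodic_with_def)

lemma R_z: "Rrot (z i) = z (- 1 - i)"
  by (simp add: z_def flip Rrot_def sg_def)

text \<open>Shifting by \<open>s\<close> negates \<open>\<xi>\<close> and so conjugates
  \<open>\<delta> (\<xi> i)\<close>. The parity of \<open>s\<close> and the axis of the given orbit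
  decide which reflection results.\<close>

lemma S_z: "(\<forall>i. Sref (z i) = z (s + i)) \<or> (\<forall>i. (Rrot \<circ> Sref) (z i) = z (s + i))"
proof -
  have \<delta>: "\<delta> (\<xi> (s + i)) = cnj (\<delta> (\<xi> i))" for i
    using shift[of i] by (simp add: add.commute oval.reflect)
  have "Sref (z i) = z (s + i)" if "cnj w = sg s * w" for i
    unfolding z_def \<delta> using that by (auto simp: Sref_def sg_def)
  moreover have "(Rrot \<circ> Sref) (z i) = z (s + i)" if "cnj w = - (sg s * w)" for i
    unfolding z_def \<delta> using that by (auto simp: Sref_def Rrot_def sg_def)
  moreover have "cnj w = sg s * w \<or> cnj w = - (sg s * w)"
    using sym by (auto simp: sg_def)
  ultimately show ?thesis by blast
qed

text \<open>Composing the shift symmetry of \<open>S_z\<close> with the time reversal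
  \<open>R_z\<close> realises the remaining reflection as a time reversal.\<close>

lemma D2_sym: "G_symmetric D2 z"
proof -
  have RS: "(Rrot \<circ> Sref) (z i) = z (- 1 - s - i)" if "\<forall>i. Sref (z i) = z (s + i)" for i
    using that R_z[of "s + i"] by (simp add: algebra_simps)
  have S: "Sref (z i) = z (- 1 - s - i)" if "\<forall>i. (Rrot \<circ> Sref) (z i) = z (s + i)" for i
  proof -
    have "Sref (z i) = Rrot ((Rrot \<circ> Sref) (z i))" by (simp add: Rrot_def)
    then show ?thesis using that R_z[of "s + i"] by (simp add: algebra_simps)
  qed
  have id: "\<exists>k. (\<forall>i. id (z i) = z (k + i)) \<or> (\<forall>i. id (z i) = z (k - i))"
    by (rule exI[of _ 0]) simp
  have R: "\<exists>k. (\<forall>i. Rrot (z i) = z (k + i)) \<or> (\<forall>i. Rrot (z i) = z (k - i))"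
    using R_z by blast
  show ?thesis
    unfolding G_symmetric_def D2_def using id R S_z RS S by (simp only: ball_simps) blast
qed

text \<open>Any two lifts differ by a constant, as their gaps lie strictly between 0 and 1.
  Comparing index 0 of a Birkhoff lift with index 2 shifted by 1 cancels the linear parts and makes
  \<open>\<xi>\<close> monotone along steps of 2.\<close>

lemma not_birkhoff: "\<not> birkhoff_seq \<gamma> z"
proof
  assume "birkhoff_seq \<gamma> z"
  then obtain y where y: "is_lift \<gamma> z y" "birkhoff y" by (auto simp: birkhoff_seq_def)
  have int: "y i - x i \<in> \<int>" for i
    using y(1) \<gamma>_x by (simp add: is_lift_def flip: eq_iff)
  have step: "y (i + 1) - x (i + 1) = y i - x i" for i
  proof -
    have "(y (i + 1) - x (i + 1)) - (y i - x i) \<in> \<int>" using Ints_diff[OF int int] .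
    then obtain n where n: "(y (i + 1) - x (i + 1)) - (y i - x i) = of_int n" by (elim Ints_cases)
    have "0 < y (i + 1) - y i" "y (i + 1) - y i < 1" "0 < x (i + 1) - x i" "x (i + 1) - x i < 1"
      using y(1) lift by (auto simp: is_lift_def)
    then have "real_of_int n < 1" "- 1 < real_of_int n" using n by linarith+
    then have "n = 0" by linarith
    then show ?thesis using n by simp
  qed
  have const: "y i - x i = y 0 - x 0" for i
  proof (induction i rule: int_induct[where k=0])
    case (step1 i)
    then show ?case using step[of i] by simp
  next
    case (step2 i)
    then show ?case using step[of "i - 1"] by simp
  qed simp
  define c where "c = \<tau> + (y 0 - x 0)"
  have y_eq: "y i = of_int i / 2 + \<xi> i + c" for i
    using const[of i] by (simp add: x_def c_def)
  have "(\<forall>i. \<xi> i \<le> \<xi> (i + 2)) \<or> (\<forall>i. \<xi> (i + 2) \<le> \<xi> i)"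
  proof (cases "\<xi> 0 \<le> \<xi> 2")
    case True
    then have "y 0 \<le> y 2 + of_int (- 1)" unfolding y_eq[of 2] y_eq[of 0] by simp
    then have le: "y (0 + m) \<le> y (2 + m) + of_int (- 1)" for m
      using y(2) unfolding birkhoff_def by blast
    have "\<xi> m \<le> \<xi> (m + 2)" for m
      using le[of m] y_eq[of m] y_eq[of "m + 2"] by (simp add: add.commute add_divide_distrib)
    then show ?thesis by blast
  next
    case False
    then have "y 2 \<le> y 0 + of_int 1" unfolding y_eq[of 2] y_eq[of 0] by simp
    then have le: "y (2 + m) \<le> y (0 + m) + of_int 1" for m
      using y(2) unfolding birkhoff_def by blast
    have "\<xi> (m + 2) \<le> \<xi> m" for m
      using le[of m] y_eq[of m] y_eq[of "m + 2"] by (simp add: add.commute add_divide_distrib)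
    then show ?thesis by blast
  qed
  then show False by (rule not_monotone)
qed

lemma rotation_half: "has_rotation_number \<gamma> z (1/2)"
proof -
  have "(\<lambda>n. x (int n) / real n - 1/2) \<longlonglongrightarrow> 0"
  proof (rule Lim_null_comparison)
    show "(\<lambda>n. (\<bar>\<tau>\<bar> + 1) / real n) \<longlonglongrightarrow> 0" by (rule lim_const_over_n)
    show "\<forall>\<^sub>F n in sequentially. norm (x (int n) / real n - 1/2) \<le> (\<bar>\<tau>\<bar> + 1) / real n"
      using eventually_gt_at_top[of 0]
    proof eventually_elim
      case (elim n)
      then have "x (int n) / real n - 1/2 = (\<tau> + \<xi> (int n)) / real n" by (simp add: x_def field_simps)
      moreover have "\<bar>\<tau> + \<xi> (int n)\<bar> \<le> \<bar>\<tau>\<bar> + 1" using small[of "int n"] by linarith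
      ultimately show ?case by (simp add: divide_right_mono)
    qed
  qed
  then have "(\<lambda>n. x (int n) / real n) \<longlonglongrightarrow> 1/2" by (simp add: LIM_zero_iff)
  then show ?thesis using lift unfolding has_rotation_number_def by blast
qed

text \<open>Two reversors compose to a translation, so a second \<open>k\<close> would yield the
  period \<open>2 * s - 1 - k\<close>, below the minimal one.\<close>

lemma unique_reversor: "\<exists>!k. odd k \<and> 0 < k \<and> k < 2 * s \<and> (\<forall>i. Rrot (z i) = z (k - i))"
proof (rule ex1I[of _ "2 * s - 1"])
  have "z (2 * s - 1 - i) = z (- 1 - i)" for i
    using z_periodic[of "- 1 - i"] by (simp add: algebra_simps)
  then show *: "odd (2 * s - 1) \<and> 0 < 2 * s - 1 \<and> 2 * s - 1 < 2 * s \<and> (\<forall>i. Rrot (z i) = z (2 * s - 1 - i))"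
    using s R_z by auto
  fix k assume k: "odd k \<and> 0 < k \<and> k < 2 * s \<and> (\<forall>i. Rrot (z i) = z (k - i))"
  then have "z (k - i) = z (2 * s - 1 - i)" for i using * by metis
  from this[of "k - i" for i] have "z (i + (2 * s - 1 - k)) = z i" for i
    by (simp add: algebra_simps)
  then have "periodic_with z (2 * s - 1 - k)" by (simp add: periodic_with_def)
  then show "k = 2 * s - 1"
    using no_period[of "2 * s - 1 - k"] k by force
qed

end

theorem mainTheorem2:
  fixes \<gamma> :: "real \<Rightarrow> complex" and Z :: "int \<Rightarrow> complex" and s :: int
  assumes curve: "billiard_curve \<gamma>" and equiv: "D2_equivariant \<gamma>"
    and Zorb: "billiard_orbit \<gamma> Z" and Zsym: "G_symmetric D2 Z"
    and Zper: "periodic_with Z 2" and ZB: "birkhoff_seq \<gamma> Z"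
    and s2: "s \<ge> 2"
    and small: "curvature_at \<gamma> (Z 0) * cmod (Z 1 - Z 0) < 2 * (cos (pi / of_int (2 * s)))\<^sup>2"
  shows "(\<forall>i. cmod (Z (i + 1) - Z i) = cmod (Z 1 - Z 0) \<and> curvature_at \<gamma> (Z i) = curvature_at \<gamma> (Z 0))
    \<and> (\<exists>z. billiard_orbit \<gamma> z \<and> G_symmetric D2 z \<and> \<not> birkhoff_seq \<gamma> z
          \<and> minimal_period z (2 * s) \<and> has_rotation_number \<gamma> z (1/2)
          \<and> (\<exists>!k. odd k \<and> 0 < k \<and> k < 2 * s \<and> (\<forall>i. Rrot (z i) = z (k - i)))
          \<and> ((\<forall>i. Sref (z i) = z (s + i)) \<or> (\<forall>i. (Rrot \<circ> Sref) (z i) = z (s + i)))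
          \<and> (\<exists>x X. is_lift \<gamma> z x \<and> is_lift \<gamma> Z X \<and> x \<in> X_pq (2 * s) s \<and> X \<in> X_pq (2 * s) s
                 \<and> sign_changes (2 * s) (\<lambda>i. x i - X i) = 2))"
proof -
  interpret billiard \<gamma> by unfold_locales (rule curve equiv)+
  have Zseq: "billiard_sequence \<gamma> Z" using Zorb by (simp add: billiard_orbit_def)
  note Z = two_periodic_antipodal[OF Zseq Zsym Zper]
  obtain \<tau> where \<tau>: "Z 0 = \<gamma> \<tau>"
    using Zseq unfolding billiard_sequence_def curve_def by blast
  define r w where "r = cmod (Z 0)" and "w = Z 0 / of_real r"
  have r: "0 < r" using nonzero \<tau> by (simp add: r_def)
  have w: "\<gamma> \<tau> = of_real r * w" "cmod w = 1" "cnj w = w \<or> cnj w = - w"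
    using r Z(2) \<tau> by (auto simp: w_def r_def norm_divide)
  interpret antipodal_orbit \<gamma> \<tau> r w
    by unfold_locales (use r w in auto)
  have diff: "cmod (Z (i + 1) - Z i) = 2 * r" for i
    using Z(3)[of i] Z(3)[of "i + 1"] by (auto simp: r_def norm_minus_commute simp flip: mult_2)
  have curv: "curvature_at \<gamma> (Z i) = curvature_at \<gamma> (Z 0)" for i
  proof -
    have "curvature \<gamma> (\<tau> + 1/2) = curvature \<gamma> \<tau>"
      by (simp add: curvature_def d_half)
    then have "curvature_at \<gamma> (- \<gamma> \<tau>) = curvature_at \<gamma> (\<gamma> \<tau>)"
      by (metis curvature_at_param half)
    then show ?thesis using Z(3)[of i] \<tau> by simp
  qed
  \<comment> \<open>The hypothesis on \<kappa> L, with L = 2 r, is multiplied by the positive number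
    \<open>(Im (\<delta>1 0))\<^sup>2 / 2\<close>.\<close>
  have "- Re (\<delta>2 0) * Re (\<delta> 0) < (Im (\<delta>1 0))\<^sup>2 * (cos (pi / (2 * s)))\<^sup>2"
  proof -
    have "- Re (\<delta>2 0) / (Im (\<delta>1 0))\<^sup>2 * (2 * r) < 2 * (cos (pi / (2 * s)))\<^sup>2"
      using small diff[of 0] unfolding \<tau> curvature_base by simp
    moreover have "- Re (\<delta>2 0) / (Im (\<delta>1 0))\<^sup>2 * (2 * r) = 2 * ((- Re (\<delta>2 0) * r) / (Im (\<delta>1 0))\<^sup>2)"
      by simp
    ultimately have "(- Re (\<delta>2 0) * r) / (Im (\<delta>1 0))\<^sup>2 < (cos (pi / (2 * s)))\<^sup>2"
      by linarith
    moreover have "0 < (Im (\<delta>1 0))\<^sup>2" using oval.\<delta>1_0 by simp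
    ultimately show ?thesis
      unfolding base_radius by (simp only: pos_divide_less_eq mult.commute)
  qed
  then obtain \<xi> where \<xi>: "\<And>i. \<xi> (i + s) = - \<xi> i" "\<And>i. \<xi> (- 1 - i) = \<xi> i" "\<And>i. \<bar>\<xi> i\<bar> < 1/4"
    "\<And>i. 0 \<le> i \<Longrightarrow> 2 * i + 1 < s \<Longrightarrow> 0 < \<xi> i"
    "\<And>i. oval.D (\<xi> i) (\<xi> (i - 1)) + oval.D (\<xi> i) (\<xi> (i + 1)) = 0"
    using oval.exists_profile[OF s2] by blast
  interpret type_II \<gamma> \<tau> r w \<xi> s
  proof unfold_locales
    show "2 \<le> s" by (rule s2)
    show "\<xi> (i + s) = - \<xi> i" "\<xi> (- 1 - i) = \<xi> i" "\<bar>\<xi> i\<bar> < 1/4"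
      "oval.D (\<xi> i) (\<xi> (i - 1)) + oval.D (\<xi> i) (\<xi> (i + 1)) = 0" for i
      by (rule \<xi>)+
    show "0 < \<xi> i" if "0 \<le> i" "2 * i + 1 < s" for i
      using that by (rule \<xi>(4))
  qed
  define X where "X i = \<tau> + of_int i / 2" for i :: int
  have "is_lift \<gamma> Z X"
    unfolding X_def using Z(3) unfolding \<tau> by (rule half_integer_lift)
  moreover have "x \<in> X_pq (2 * s) s" "X \<in> X_pq (2 * s) s"
    by (auto simp: X_pq_def x_def X_def wave_periodic add_divide_distrib)
  moreover have "sign_changes (2 * s) (\<lambda>i. x i - X i) = 2"
    using sign_changes_eq_2 by (simp add: x_def X_def)
  ultimately have "\<exists>x X. is_lift \<gamma> z x \<and> is_lift \<gamma> Z X \<and> x \<in> X_pq (2 * s) s \<and> X \<in> X_pq (2 * s) s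
      \<and> sign_changes (2 * s) (\<lambda>i. x i - X i) = 2"
    using lift by blast
  moreover have "\<forall>i. cmod (Z (i + 1) - Z i) = cmod (Z 1 - Z 0) \<and> curvature_at \<gamma> (Z i) = curvature_at \<gamma> (Z 0)"
    using diff diff[of 0] curv by simp
  ultimately show ?thesis
    using orbit D2_sym not_birkhoff min_period rotation_half unique_reversor S_z by blast
qed

end
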